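(* Let $G$ be a finite group, $\mathcal K$ a field of characteristic $0$, and $\rho$ a self-dual $\mathcal KG$-representation such that $\rho\otimes_{\mathcal K}\bar{\mathcal K}$ admits a nondegenerate alternating $G$-invariant bilinear pairing. Then $\mathcal C_\Theta(\rho)=1$ in $\mathcal K^\times/\mathcal K^{\times2}$ for every $G$-relation $\Theta$.
   Context: A $G$-relation is a formal $\mathbb Z$-combination $\Theta=\sum_in_iH_i$ of conjugacy classes of subgroups of $G$ with $\bigoplus_i\mathbb C[G/H_i]^{\oplus n_i}=0$ as virtual representation. The regulator constant is $\mathcal C_\Theta(\rho)=\prod_i\det(\frac1{|H_i|}\langle,\rangle\mid\rho^{H_i})^{n_i}\in\mathcal K^\times/\mathcal K^{\times2}$, where $\langle,\rangle$ is any nondegenerate $G$-invariant $\mathcal K$-bilinear pairing on $\rho$ and $\det(\cdot\mid\rho^{H})$ is the Gram determinant on a $\mathcal K$-basis of the $H$-invariants; it is independent of the choice of pairing. *)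

theory Defs
  imports "HOL-Algebra.Coset" "Jordan_Normal_Form.Determinant"
    "HOL-Computational_Algebra.Polynomial"
begin

definition is_rep :: "('a, 'b) monoid_scheme \<Rightarrow> nat \<Rightarrow> ('a \<Rightarrow> 'k::field mat) \<Rightarrow> bool" where
  "is_rep G n \<rho> \<longleftrightarrow>
     (\<forall>g\<in>carrier G. \<rho> g \<in> carrier_mat n n) \<and>
     \<rho> \<one>\<^bsub>G\<^esub> = 1\<^sub>m n \<and>
     (\<forall>g\<in>carrier G. \<forall>h\<in>carrier G. \<rho> (g \<otimes>\<^bsub>G\<^esub> h) = \<rho> g * \<rho> h)"

definition self_dual :: "('a, 'b) monoid_scheme \<Rightarrow> nat \<Rightarrow> ('a \<Rightarrow> 'k::field mat) \<Rightarrow> bool" where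
  "self_dual G n \<rho> \<longleftrightarrow>
     (\<exists>P \<in> carrier_mat n n. det P \<noteq> 0 \<and>
        (\<forall>g\<in>carrier G. P * \<rho> g = transpose_mat (\<rho> (inv\<^bsub>G\<^esub> g)) * P))"

definition invariant_pairing :: "('a, 'b) monoid_scheme \<Rightarrow> nat \<Rightarrow> ('a \<Rightarrow> 'k::field mat) \<Rightarrow> 'k mat \<Rightarrow> bool" where
  "invariant_pairing G n \<rho> B \<longleftrightarrow>
     B \<in> carrier_mat n n \<and> det B \<noteq> 0 \<and>
     (\<forall>g\<in>carrier G. transpose_mat (\<rho> g) * B * \<rho> g = B)"

definition alternating :: "nat \<Rightarrow> 'k::field mat \<Rightarrow> bool" where
  "alternating n B \<longleftrightarrow> (\<forall>v\<in>carrier_vec n. v \<bullet> (B *\<^sub>v v) = 0)"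

definition field_embedding :: "('k::field \<Rightarrow> 'l::field) \<Rightarrow> bool" where
  "field_embedding e \<longleftrightarrow> inj e \<and> e 1 = 1 \<and>
     (\<forall>x y. e (x + y) = e x + e y) \<and> (\<forall>x y. e (x * y) = e x * e y)"

definition is_algebraic_closure :: "('k::field \<Rightarrow> 'l::alg_closed_field) \<Rightarrow> bool" where
  "is_algebraic_closure e \<longleftrightarrow> field_embedding e \<and>
     (\<forall>x::'l. \<exists>p::'k poly. p \<noteq> 0 \<and> poly (map_poly e p) x = 0)"

definition invariants :: "('a, 'b) monoid_scheme \<Rightarrow> nat \<Rightarrow> ('a \<Rightarrow> 'k::field mat) \<Rightarrow> 'a set \<Rightarrow> 'k vec set" where
  "invariants G n \<rho> H = {v \<in> carrier_vec n. \<forall>h\<in>H. \<rho> h *\<^sub>v v = v}"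

definition lincomb :: "nat \<Rightarrow> 'k::field list \<Rightarrow> 'k vec list \<Rightarrow> 'k vec" where
  "lincomb n cs vs = vec n (\<lambda>k. \<Sum>j<length vs. cs ! j * (vs ! j) $ k)"

definition is_basis :: "nat \<Rightarrow> 'k::field vec set \<Rightarrow> 'k vec list \<Rightarrow> bool" where
  "is_basis n V vs \<longleftrightarrow> set vs \<subseteq> V \<and>
     (\<forall>v\<in>V. \<exists>!cs. length cs = length vs \<and> lincomb n cs vs = v)"

definition gram_mat :: "'k::field mat \<Rightarrow> 'k vec list \<Rightarrow> 'k mat" where
  "gram_mat B vs = mat (length vs) (length vs) (\<lambda>(i, j). (vs ! i) \<bullet> (B *\<^sub>v (vs ! j)))"

definition lcosets :: "('a, 'b) monoid_scheme \<Rightarrow> 'a set \<Rightarrow> 'a set set" where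
  "lcosets G H = {a <#\<^bsub>G\<^esub> H | a. a \<in> carrier G}"

text \<open>The G-set underlying the sum over i with sign s of C[G/H_i]^{|n_i|}:
  triples (i, k, xH_i) with k < |n_i|.\<close>
definition rel_gset :: "('a, 'b) monoid_scheme \<Rightarrow> ('a set \<times> int) list \<Rightarrow> bool \<Rightarrow> (nat \<times> nat \<times> 'a set) set" where
  "rel_gset G \<Theta> pos = {(i, k, C). i < length \<Theta> \<and>
      (if pos then snd (\<Theta> ! i) > 0 else snd (\<Theta> ! i) < 0) \<and>
      k < nat \<bar>snd (\<Theta> ! i)\<bar> \<and> C \<in> lcosets G (fst (\<Theta> ! i))}"

definition gset_act :: "('a, 'b) monoid_scheme \<Rightarrow> 'a \<Rightarrow> nat \<times> nat \<times> 'a set \<Rightarrow> nat \<times> nat \<times> 'a set" where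
  "gset_act G g x = (case x of (i, k, C) \<Rightarrow> (i, k, g <#\<^bsub>G\<^esub> C))"

text \<open>Theta = sum n_i H_i is a G-relation: all H_i are subgroups and
  the complex permutation representations of the positive and negative parts are
  isomorphic, i.e. there is an invertible G-equivariant matrix between them.\<close>
definition G_relation :: "('a, 'b) monoid_scheme \<Rightarrow> ('a set \<times> int) list \<Rightarrow> bool" where
  "G_relation G \<Theta> \<longleftrightarrow>
     (\<forall>i<length \<Theta>. subgroup (fst (\<Theta> ! i)) G) \<and>
     (let X = rel_gset G \<Theta> True; Y = rel_gset G \<Theta> False in
      \<exists>(M :: nat \<times> nat \<times> 'a set \<Rightarrow> nat \<times> nat \<times> 'a set \<Rightarrow> complex)
       (N :: nat \<times> nat \<times> 'a set \<Rightarrow> nat \<times> nat \<times> 'a set \<Rightarrow> complex).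
        (\<forall>y\<in>Y. \<forall>y'\<in>Y. (\<Sum>x\<in>X. M y x * N x y') = (if y = y' then 1 else 0)) \<and>
        (\<forall>x\<in>X. \<forall>x'\<in>X. (\<Sum>y\<in>Y. N x y * M y x') = (if x = x' then 1 else 0)) \<and>
        (\<forall>g\<in>carrier G. \<forall>y\<in>Y. \<forall>x\<in>X. M (gset_act G g y) (gset_act G g x) = M y x))"

text \<open>The representative prod_i det(1/|H_i| <,> | rho^{H_i})^{n_i} computed with the
  pairing matrix B and bases bs i of the invariants.\<close>
definition reg_const_value :: "('a set \<times> int) list \<Rightarrow> 'k::field mat \<Rightarrow> (nat \<Rightarrow> 'k vec list) \<Rightarrow> 'k" where
  "reg_const_value \<Theta> B bs =
     (\<Prod>i<length \<Theta>. det ((1 / of_nat (card (fst (\<Theta> ! i)))) \<cdot>\<^sub>m gram_mat B (bs i))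
                        powi snd (\<Theta> ! i))"

text \<open>C_Theta(rho) = 1 in K^x/K^x2: for every admissible choice of pairing and bases
  the value is a nonzero square.\<close>
definition reg_const_trivial :: "('a, 'b) monoid_scheme \<Rightarrow> nat \<Rightarrow> ('a \<Rightarrow> 'k::field mat) \<Rightarrow> ('a set \<times> int) list \<Rightarrow> bool" where
  "reg_const_trivial G n \<rho> \<Theta> \<longleftrightarrow>
     (\<forall>B bs. invariant_pairing G n \<rho> B \<and>
        (\<forall>i<length \<Theta>. is_basis n (invariants G n \<rho> (fst (\<Theta> ! i))) (bs i)) \<longrightarrow>
        (\<exists>c. c \<noteq> 0 \<and> reg_const_value \<Theta> B bs = c ^ 2))"

end

theory Submission
  imports Defs "Jordan_Normal_Form.Char_Poly"
begin

text \<open>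
  The alternating pairing descends to \<open>\<K>\<close>: averaging over \<open>G\<close> writes it as a combination, with
  coefficients in the algebraic closure, of skew invariant matrices over \<open>\<K>\<close>; its determinant is a
  polynomial in these coefficients that does not vanish identically, so it is nonzero at some
  coefficients in the infinite field \<open>\<K>\<close>. For such a pairing \<open>A\<close> every Gram matrix is
  skew-symmetric, so its determinant is a square.

  Any other invariant pairing has the form \<open>A * T\<close> with \<open>T\<close> commuting with \<open>G\<close>, which multiplies the
  Gram determinant on \<open>\<rho>\<^sup>H\<close> by \<open>det (T | \<rho>\<^sup>H)\<close>. As \<open>tr (T^k | \<rho>\<^sup>H)\<close> is the mean over \<open>H\<close> of the
  class function \<open>g \<mapsto> tr (T^k \<rho>(g))\<close>, and as the permutation characters in a relation cancel,
  the sums \<open>\<Sum>\<^sub>i n\<^sub>i tr (T^k | \<rho>\<^sup>H\<^sup>i)\<close> vanish for all \<open>k\<close>. Hence every eigenvalue has total weighted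
  multiplicity zero, and \<open>\<Prod>\<^sub>i det (T | \<rho>\<^sup>H\<^sup>i)^n\<^sub>i = 1\<close>.
\<close>

section \<open>Traces and skew-symmetric determinants\<close>

lemma inverse_mat_exists:
  fixes A :: "'k::field mat"
  assumes A: "A \<in> carrier_mat n n" and "det A \<noteq> 0"
  obtains B where "B \<in> carrier_mat n n" "A * B = 1\<^sub>m n" "B * A = 1\<^sub>m n"
  using det_non_zero_imp_unit[OF assms, of "()"] that
  unfolding Units_def ring_mat_def by auto

lemma index_mult_mat_sum:
  assumes "A \<in> carrier_mat n m" "B \<in> carrier_mat m p" "i < n" "j < p"
  shows "(A * B) $$ (i, j) = (\<Sum>k<m. A $$ (i, k) * B $$ (k, j))"
  using assms by (auto simp: scalar_prod_def atLeast0LessThan intro!: sum.cong)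

definition mat_trace :: "'k::comm_ring_1 mat \<Rightarrow> 'k" where
  "mat_trace A = (\<Sum>i<dim_row A. A $$ (i, i))"

lemma mat_trace_mult_commute:
  assumes A: "A \<in> carrier_mat n m" and B: "B \<in> carrier_mat m n"
  shows "mat_trace (A * B) = mat_trace (B * A)"
proof -
  have "mat_trace (A * B) = (\<Sum>i<n. \<Sum>k<m. A $$ (i, k) * B $$ (k, i))"
    unfolding mat_trace_def using assms
    by (auto simp del: index_mult_mat(1) simp: index_mult_mat_sum[OF A B] intro!: sum.cong)
  also have "\<dots> = (\<Sum>k<m. \<Sum>i<n. B $$ (k, i) * A $$ (i, k))"
    by (subst sum.swap) (simp add: mult.commute)
  also have "\<dots> = mat_trace (B * A)"
    unfolding mat_trace_def using assms
    by (auto simp del: index_mult_mat(1) simp: index_mult_mat_sum[OF B A] intro!: sum.cong)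
  finally show ?thesis .
qed

text \<open>Symmetric pivoting: a nonzero entry of the first column yields a skew 2x2 block whose
  determinant is a square, and its Schur complement is again skew with zero diagonal, so induction
  applies. The zero diagonal is assumed separately because skewness does not force it in
  characteristic 2.\<close>

lemma det_skew_symmetric_square:
  fixes X :: "'k::field mat"
  assumes "X \<in> carrier_mat d d"
    and "\<And>i j. i < d \<Longrightarrow> j < d \<Longrightarrow> X $$ (j, i) = - X $$ (i, j)"
    and "\<And>i. i < d \<Longrightarrow> X $$ (i, i) = 0"
  shows "\<exists>c. det X = c ^ 2"
  using assms
proof (induction d arbitrary: X rule: less_induct)
  case (less d)
  note X = less.prems(1) and skew = less.prems(2) and diag = less.prems(3)
  show ?case
  proof (cases "\<forall>i<d. X $$ (i, 0) = 0")
    case True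
    show ?thesis
    proof (cases "d = 0")
      case True
      then show ?thesis using X by (intro exI[of _ 1]) auto
    next
      case False
      have "det X = 0"
        using laplace_expansion_column[OF X, of 0] False True by simp
      then show ?thesis by (intro exI[of _ 0]) auto
    qed
  next
    case False
    then obtain i where i: "i < d" "X $$ (i, 0) \<noteq> 0" by auto
    with diag have i0: "i \<noteq> 0" by metis
    have "2 \<le> d" using i i0 by simp
    then obtain m where d: "d = 2 + m" using le_Suc_ex by blast
    \<comment> \<open>The swap moves the nonzero entry from (i, 0) to (1, 0). Applied to rows and
      columns alike, it keeps the matrix skew, and the two signs cancel in the determinant.\<close>
    define \<sigma> where "\<sigma> = Transposition.transpose 1 i"
    have \<sigma>: "\<sigma> permutes {0..<d}" unfolding \<sigma>_def using i d by (intro permutes_swap_id) auto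
    have \<sigma>d: "\<sigma> r < d" if "r < d" for r using permutes_in_image[OF \<sigma>, of r] that by auto
    define Y where "Y = mat d d (\<lambda>(r, c). X $$ (\<sigma> r, \<sigma> c))"
    have Y: "Y \<in> carrier_mat d d" unfolding Y_def by auto
    have "det Y = det X"
    proof -
      define Z where "Z = mat d d (\<lambda>(r, c). X $$ (\<sigma> r, c))"
      have Z: "Z \<in> carrier_mat d d" unfolding Z_def by auto
      have "Y = transpose_mat (mat d d (\<lambda>(r, c). transpose_mat Z $$ (\<sigma> r, c)))"
        unfolding Y_def Z_def using \<sigma>d by (intro eq_matI) auto
      then have "det Y = signof \<sigma> * det (transpose_mat Z)"
        using det_permute_rows[OF transpose_carrier_mat[THEN iffD2, OF Z] \<sigma>] by (simp add: det_transpose[of _ d])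
      also have "\<dots> = signof \<sigma> * (signof \<sigma> * det X)"
        using det_permute_rows[OF X \<sigma>] det_transpose[OF Z] unfolding Z_def by simp
      finally show ?thesis by (auto simp: sign_def split: if_splits)
    qed
    have Yskew: "Y $$ (s, r) = - Y $$ (r, s)" if "r < d" "s < d" for r s
      using that skew[OF \<sigma>d \<sigma>d, of r s] unfolding Y_def by simp
    have Ydiag: "Y $$ (r, r) = 0" if "r < d" for r
      using that diag[OF \<sigma>d, of r] unfolding Y_def by simp
    define a where "a = Y $$ (0, 1)"
    have a: "a \<noteq> 0"
      unfolding a_def Y_def \<sigma>_def using i i0 d skew[of i 0]
      by (auto simp: Transposition.transpose_def)
    \<comment> \<open>\<open>P\<close> clears the upper right block of \<open>Y\<close>, leaving the Schur complement of its leading \<open>2 \<times> 2\<close> block.\<close>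
    define \<alpha> where "\<alpha> c = (if c < 2 then 0 else Y $$ (1, c) / a)" for c
    define \<beta> where "\<beta> c = (if c < 2 then 0 else - Y $$ (0, c) / a)" for c
    define P where "P = mat d d (\<lambda>(r, c). (if r = c then 1 else 0) + (if r = 0 then \<alpha> c else 0)
      + (if r = 1 then \<beta> c else 0))"
    have P: "P \<in> carrier_mat d d" unfolding P_def by auto
    have detP: "det P = 1"
    proof -
      have "upper_triangular P" unfolding P_def \<alpha>_def \<beta>_def using d by auto
      then have "det P = prod_list (diag_mat P)" by (rule det_upper_triangular[OF _ P])
      also have "diag_mat P = map (\<lambda>i. 1) [0..<d]"
        unfolding diag_mat_def P_def \<alpha>_def \<beta>_def by auto
      also have "prod_list (map (\<lambda>i. 1::'k) [0..<d]) = 1" by (induction d) auto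
      finally show ?thesis .
    qed
    have YP: "(Y * P) $$ (r, c) = Y $$ (r, c) + Y $$ (r, 0) * \<alpha> c + Y $$ (r, 1) * \<beta> c"
      if "r < d" "c < d" for r c
    proof -
      have "(Y * P) $$ (r, c) = (\<Sum>k<d. Y $$ (r, k) * P $$ (k, c))"
        by (rule index_mult_mat_sum[OF Y P that])
      also have "\<dots> = (\<Sum>k<d. (if k = c then Y $$ (r, c) else 0) + (if k = 0 then Y $$ (r, 0) * \<alpha> c else 0)
          + (if k = 1 then Y $$ (r, 1) * \<beta> c else 0))"
        by (rule sum.cong) (use that in \<open>auto simp: P_def algebra_simps\<close>)
      also have "\<dots> = Y $$ (r, c) + Y $$ (r, 0) * \<alpha> c + Y $$ (r, 1) * \<beta> c"
        using that d by (simp add: sum.distrib)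
      finally show ?thesis .
    qed
    define J where "J = mat 2 2 (\<lambda>(r, c). Y $$ (r, c))"
    define F where "F = mat m 2 (\<lambda>(r, c). Y $$ (r + 2, c))"
    define D where "D = mat m m (\<lambda>(r, c). (Y * P) $$ (r + 2, c + 2))"
    \<comment> \<open>The correction term changes sign when \<open>r\<close> and \<open>c\<close>
      are exchanged, which makes the Schur complement \<open>D\<close> skew.\<close>
    have D_eq: "D $$ (r, c) = Y $$ (r + 2, c + 2)
        - (Y $$ (0, r + 2) * Y $$ (1, c + 2) - Y $$ (1, r + 2) * Y $$ (0, c + 2)) / a"
      if "r < m" "c < m" for r c
      using that d Yskew[of 0 "r + 2"] Yskew[of 1 "r + 2"] unfolding D_def
      by (simp add: YP \<alpha>_def \<beta>_def diff_divide_distrib)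
    have block: "Y * P = four_block_mat J (0\<^sub>m 2 m) F D"
    proof (rule eq_matI)
      fix r c assume "r < dim_row (four_block_mat J (0\<^sub>m 2 m) F D)" "c < dim_col (four_block_mat J (0\<^sub>m 2 m) F D)"
      then have rc: "r < d" "c < d" by (auto simp: J_def D_def d)
      have "(Y * P) $$ (r, c) = 0" if "r < 2" "2 \<le> c"
      proof -
        from that consider "r = 0" | "r = 1" by linarith
        then show ?thesis
          using that rc d a Ydiag[of 0] Ydiag[of 1] Yskew[of 0 1] a_def
          by cases (simp_all add: YP \<alpha>_def \<beta>_def)
      qed
      moreover have "(Y * P) $$ (r, c) = Y $$ (r, c)" if "c < 2"
        using that rc by (simp add: YP \<alpha>_def \<beta>_def)
      moreover have "Suc (Suc (s - 2)) = s" if "\<not> s < 2" for s :: nat using that by simp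
      ultimately show "(Y * P) $$ (r, c) = four_block_mat J (0\<^sub>m 2 m) F D $$ (r, c)"
        using rc by (auto simp: J_def F_def D_def d simp del: index_mult_mat)
    qed (use Y P d in \<open>auto simp: J_def D_def\<close>)
    have "det Y = det (Y * P)" using det_mult[OF Y P] detP by simp
    also have "\<dots> = det J * det D"
      unfolding block by (rule det_four_block_mat_upper_right_zero) (auto simp: J_def F_def D_def)
    also have "det J = a ^ 2"
    proof -
      have "Y $$ (Suc 0, 0) = - Y $$ (0, Suc 0)" "Y $$ (0, 0) = 0" "Y $$ (Suc 0, Suc 0) = 0"
        using Ydiag[of 0] Ydiag[of 1] Yskew[of 0 1] d by auto
      then have "J = four_block_mat (0\<^sub>m 1 1) (mat 1 1 (\<lambda>_. a)) (mat 1 1 (\<lambda>_. - a)) (0\<^sub>m 1 1)"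
        by (intro eq_matI) (auto simp: J_def a_def less_Suc_eq)
      then have "det J = det (0\<^sub>m 1 1 * 0\<^sub>m 1 1 - mat 1 1 (\<lambda>_. a) * mat 1 1 (\<lambda>_. - a))"
        by (simp only:) (rule det_four_block_mat[of _ 1], auto)
      also have "\<dots> = a ^ 2"
        by (subst det_single) (auto simp: scalar_prod_def power2_eq_square)
      finally show ?thesis .
    qed
    finally have "det X = a ^ 2 * det D" using \<open>det Y = det X\<close> by simp
    moreover have "\<exists>c. det D = c ^ 2"
    proof (rule less.IH)
      show "m < d" using d by simp
      show "D \<in> carrier_mat m m" unfolding D_def by simp
      show "D $$ (s, r) = - D $$ (r, s)" if "r < m" "s < m" for r s
        using that Yskew[of "r + 2" "s + 2"] d a by (simp add: D_eq field_simps)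
      show "D $$ (r, r) = 0" if "r < m" for r
        using that Ydiag[of "r + 2"] d by (simp add: D_eq)
    qed
    ultimately show ?thesis by (metis power_mult_distrib)
  qed
qed

section \<open>Eigenvalues and power sums\<close>

lemma eigenvalue_exists:
  fixes T :: "'l::alg_closed_field mat"
  assumes T: "T \<in> carrier_mat n n" and "n \<noteq> 0"
  obtains v x where "v \<in> carrier_vec n" "v \<noteq> 0\<^sub>v n" "T *\<^sub>v v = x \<cdot>\<^sub>v v"
proof -
  have "degree (char_poly T) > 0" using degree_monic_char_poly[OF T] assms by simp
  then obtain x where "poly (char_poly T) x = 0"
    using alg_closed_imp_poly_has_root by blast
  then have "eigenvalue T x" using eigenvalue_root_char_poly[OF T] by simp
  then show ?thesis using that T unfolding eigenvalue_def eigenvector_def by auto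
qed

text \<open>Completes \<open>v\<close> to a basis. A row swap \<open>S\<close> brings a nonzero
  entry of \<open>v\<close> to the top; the identity matrix with its first column replaced by the
  swapped vector is then lower triangular with nonzero diagonal, hence invertible.\<close>

lemma basis_change_first_column:
  fixes v :: "'k::field vec"
  assumes v: "v \<in> carrier_vec n" and "v \<noteq> 0\<^sub>v n"
  obtains P Q where "P \<in> carrier_mat n n" "Q \<in> carrier_mat n n" "P * Q = 1\<^sub>m n" "Q * P = 1\<^sub>m n"
    "P *\<^sub>v unit_vec n 0 = v"
proof -
  obtain i where i: "i < n" "v $ i \<noteq> 0"
    using assms by (metis eq_vecI carrier_vecD index_zero_vec)
  define S :: "'k mat" where "S = swaprows_mat n 0 i"
  have S: "S \<in> carrier_mat n n" "S * S = 1\<^sub>m n"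
    unfolding S_def using swaprows_mat_inv[of 0 n i] i by auto
  define w where "w = S *\<^sub>v v"
  have w: "w \<in> carrier_vec n" unfolding w_def using S v by auto
  have "w $ 0 = (\<Sum>k<n. S $$ (0, k) * v $ k)"
    unfolding w_def using S v i by (auto simp: scalar_prod_def atLeast0LessThan)
  also have "\<dots> = (\<Sum>k<n. if k = i then v $ k else 0)"
    unfolding S_def using i by (intro sum.cong) auto
  also have "\<dots> = v $ i" using i by simp
  finally have w0: "w $ 0 \<noteq> 0" using i by simp
  define L where "L = mat n n (\<lambda>(r, c). if c = 0 then w $ r else if r = c then 1 else 0)"
  have L: "L \<in> carrier_mat n n" unfolding L_def by auto
  have "det L = prod_list (diag_mat L)"
    by (rule det_lower_triangular[OF _ L]) (auto simp: L_def)
  moreover have "0 \<notin> set (diag_mat L)" using w0 by (auto simp: diag_mat_def L_def)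
  ultimately have "det L \<noteq> 0" by (simp add: prod_list_zero_iff)
  then obtain L' where L': "L' \<in> carrier_mat n n" "L * L' = 1\<^sub>m n" "L' * L = 1\<^sub>m n"
    using inverse_mat_exists[OF L] by blast
  have Le: "L *\<^sub>v unit_vec n 0 = w"
    using i w by (intro eq_vecI) (auto simp: L_def)
  show ?thesis
  proof
    show "S * L \<in> carrier_mat n n" "L' * S \<in> carrier_mat n n" using S L L' by auto
    have "S * L * (L' * S) = S * (L * L') * S" using S(1) L L'(1) by (simp add: assoc_mult_mat[of _ n n _ n _ n])
    then show "S * L * (L' * S) = 1\<^sub>m n" using S L' by simp
    have "L' * S * (S * L) = L' * (S * S) * L" using S(1) L L'(1) by (simp add: assoc_mult_mat[of _ n n _ n _ n])
    then show "L' * S * (S * L) = 1\<^sub>m n" using S L' by simp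
    have "S * L *\<^sub>v unit_vec n 0 = S *\<^sub>v w" using S L Le by (simp add: assoc_mult_mat_vec[of _ n n _ n])
    also have "\<dots> = (S * S) *\<^sub>v v" unfolding w_def using S(1) v by (simp add: assoc_mult_mat_vec[of _ n n _ n])
    finally show "S * L *\<^sub>v unit_vec n 0 = v" using S v by simp
  qed
qed

text \<open>One step of triangularisation: in a basis that starts with an eigenvector, the first
  column is the eigenvalue followed by zeros.\<close>

lemma similar_to_block_triangular:
  fixes T :: "'l::alg_closed_field mat"
  assumes T: "T \<in> carrier_mat (Suc m) (Suc m)"
  obtains x E D P Q where "E \<in> carrier_mat 1 m" "D \<in> carrier_mat m m"
    "similar_mat_wit T (four_block_mat (mat 1 1 (\<lambda>_. x)) E (0\<^sub>m m 1) D) P Q"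
proof -
  let ?n = "Suc m"
  obtain v x where v: "v \<in> carrier_vec ?n" "v \<noteq> 0\<^sub>v ?n" "T *\<^sub>v v = x \<cdot>\<^sub>v v"
    using eigenvalue_exists[OF T] by auto
  obtain P Q where PQ: "P \<in> carrier_mat ?n ?n" "Q \<in> carrier_mat ?n ?n" "P * Q = 1\<^sub>m ?n" "Q * P = 1\<^sub>m ?n"
    and Pv: "P *\<^sub>v unit_vec ?n 0 = v"
    using basis_change_first_column[OF v(1,2)] by metis
  define B where "B = Q * T * P"
  have B: "B \<in> carrier_mat ?n ?n" unfolding B_def using PQ T by auto
  have Qv: "Q *\<^sub>v v = unit_vec ?n 0"
    using PQ by (simp flip: Pv assoc_mult_mat_vec[of _ ?n ?n _ ?n])
  have "B *\<^sub>v unit_vec ?n 0 = Q *\<^sub>v (T *\<^sub>v v)"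
    unfolding B_def using PQ T Pv by (simp add: assoc_mult_mat_vec[of _ ?n ?n _ ?n])
  also have "\<dots> = x \<cdot>\<^sub>v unit_vec ?n 0"
    using PQ v Qv by (simp add: mult_mat_vec[of _ ?n ?n])
  finally have "B *\<^sub>v unit_vec ?n 0 = x \<cdot>\<^sub>v unit_vec ?n 0" .
  then have col0: "B $$ (r, 0) = (if r = 0 then x else 0)" if "r < ?n" for r
  proof -
    have "B $$ (r, 0) = (B *\<^sub>v unit_vec ?n 0) $ r" using B that by simp
    then show ?thesis unfolding \<open>B *\<^sub>v unit_vec ?n 0 = x \<cdot>\<^sub>v unit_vec ?n 0\<close> using that by simp
  qed
  define E where "E = mat 1 m (\<lambda>(r, c). B $$ (0, c + 1))"
  define D where "D = mat m m (\<lambda>(r, c). B $$ (r + 1, c + 1))"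
  have "B = four_block_mat (mat 1 1 (\<lambda>_. x)) E (0\<^sub>m m 1) D"
    using B col0 by (intro eq_matI) (auto simp: E_def D_def)
  moreover have "similar_mat_wit T B P Q"
  proof (rule similar_mat_witI)
    have "P * B * Q = (P * Q) * T * (P * Q)"
      unfolding B_def using PQ(1,2) T by (simp add: assoc_mult_mat[of _ ?n ?n _ ?n _ ?n])
    then show "T = P * B * Q" using PQ T by simp
  qed (use PQ T B in auto)
  ultimately show ?thesis using that[of E D x P Q] unfolding E_def D_def by auto
qed

text \<open>The off-diagonal block \<open>F\<close> stays unspecified because traces see only the
  diagonal blocks.\<close>

lemma pow_block_triangular:
  assumes "A \<in> carrier_mat p p" "E \<in> carrier_mat p m" "D \<in> carrier_mat m m"
  shows "\<exists>F \<in> carrier_mat p m.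
    four_block_mat A E (0\<^sub>m m p) D ^\<^sub>m k = four_block_mat (A ^\<^sub>m k) F (0\<^sub>m m p) (D ^\<^sub>m k)"
proof (induction k)
  case 0
  show ?case using assms by (intro bexI[of _ "0\<^sub>m p m"]) auto
next
  case (Suc k)
  then obtain F where F: "F \<in> carrier_mat p m"
    "four_block_mat A E (0\<^sub>m m p) D ^\<^sub>m k = four_block_mat (A ^\<^sub>m k) F (0\<^sub>m m p) (D ^\<^sub>m k)"
    by blast
  have "four_block_mat A E (0\<^sub>m m p) D ^\<^sub>m Suc k
      = four_block_mat (A ^\<^sub>m Suc k) (A ^\<^sub>m k * E + F * D) (0\<^sub>m m p) (D ^\<^sub>m Suc k)"
    unfolding pow_mat.simps F(2) using assms F(1)
    by (subst mult_four_block_mat[of _ p p _ m _ m _ _ p _ m]) auto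
  then show ?case using assms F(1)
    by (intro bexI[of _ "A ^\<^sub>m k * E + F * D"]) auto
qed

lemma mat_trace_four_block:
  assumes "A \<in> carrier_mat p p" "D \<in> carrier_mat m m"
  shows "mat_trace (four_block_mat A B C D) = mat_trace A + mat_trace D"
proof -
  have "mat_trace (four_block_mat A B C D) = (\<Sum>i<p + m. four_block_mat A B C D $$ (i, i))"
    using assms by (simp add: mat_trace_def)
  also have "\<dots> = (\<Sum>i<p. A $$ (i, i)) + (\<Sum>i=p..<p + m. D $$ (i - p, i - p))"
  proof -
    let ?M = "four_block_mat A B C D"
    have "{..<p + m} = {..<p} \<union> {p..<p + m}" by auto
    then have "(\<Sum>i<p + m. ?M $$ (i, i)) = (\<Sum>i<p. ?M $$ (i, i)) + (\<Sum>i=p..<p + m. ?M $$ (i, i))"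
      by (simp only: sum.union_disjoint[of "{..<p}" "{p..<p + m}"] finite_lessThan finite_atLeastLessThan ivl_disj_int)
    moreover have "(\<Sum>i<p. ?M $$ (i, i)) = (\<Sum>i<p. A $$ (i, i))"
      using assms by (intro sum.cong) auto
    moreover have "(\<Sum>i=p..<p + m. ?M $$ (i, i)) = (\<Sum>i=p..<p + m. D $$ (i - p, i - p))"
      using assms by (intro sum.cong) auto
    ultimately show ?thesis by simp
  qed
  also have "(\<Sum>i=p..<p + m. D $$ (i - p, i - p)) = (\<Sum>i<m. D $$ (i, i))"
    by (rule sum.reindex_bij_witness[of _ "\<lambda>i. i + p" "\<lambda>i. i - p"]) auto
  finally show ?thesis using assms by (simp add: mat_trace_def)
qed

lemma mat_trace_similar:
  assumes "similar_mat_wit A B P Q"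
  shows "mat_trace A = mat_trace B"
proof -
  note w = similar_mat_witD[OF refl assms]
  let ?n = "dim_row A"
  have "mat_trace A = mat_trace (P * (B * Q))"
    by (rule arg_cong[of _ _ mat_trace], rule trans[OF w(3)], rule assoc_mult_mat[OF w(6,5,7)])
  also have "\<dots> = mat_trace (B * Q * P)" 
    by (rule mat_trace_mult_commute[OF w(6) mult_carrier_mat[OF w(5,7)]])
  also have "B * Q * P = B" 
    using assoc_mult_mat[OF w(5,7,6)] right_mult_one_mat[OF w(5)] unfolding w(2) by (rule trans)
  finally show ?thesis .
qed

text \<open>The list holds the eigenvalues with algebraic multiplicity, split off one at a time.
  Only their product and power sums are recorded, which is all that the comparison of determinants
  needs.\<close>

lemma eigenvalue_list_exists:
  fixes T :: "'l::alg_closed_field mat"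
  assumes "T \<in> carrier_mat n n"
  shows "\<exists>es. det T = prod_list es \<and> (\<forall>k. mat_trace (T ^\<^sub>m k) = (\<Sum>x\<leftarrow>es. x ^ k))"
  using assms
proof (induction n arbitrary: T)
  case 0
  have "mat_trace (T ^\<^sub>m k) = 0" for k
    using 0 by (simp add: mat_trace_def)
  with 0 show ?case by (intro exI[of _ "[]"]) auto
next
  case (Suc m)
  obtain x E D P Q where E: "E \<in> carrier_mat 1 m" and D: "D \<in> carrier_mat m m"
    and sim: "similar_mat_wit T (four_block_mat (mat 1 1 (\<lambda>_. x)) E (0\<^sub>m m 1) D) P Q"
    using similar_to_block_triangular[OF Suc.prems] by metis
  let ?x = "mat 1 1 (\<lambda>_. x)"
  let ?B = "four_block_mat ?x E (0\<^sub>m m 1) D"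
  obtain es where es: "det D = prod_list es" "\<And>k. mat_trace (D ^\<^sub>m k) = (\<Sum>x\<leftarrow>es. x ^ k)"
    using Suc.IH[OF D] by blast
  have xk: "?x ^\<^sub>m k = mat 1 1 (\<lambda>_. x ^ k)" for k
    by (induction k) (auto intro!: eq_matI simp: scalar_prod_def)
  have "mat_trace (T ^\<^sub>m k) = (\<Sum>x\<leftarrow>x # es. x ^ k)" for k
  proof -
    obtain F where F: "?B ^\<^sub>m k = four_block_mat (?x ^\<^sub>m k) F (0\<^sub>m m 1) (D ^\<^sub>m k)"
      using pow_block_triangular[of ?x 1 E m D k] E D by auto
    have "mat_trace (T ^\<^sub>m k) = mat_trace (?B ^\<^sub>m k)"
      by (rule mat_trace_similar[OF similar_mat_wit_pow[OF sim]])
    also have "\<dots> = mat_trace (?x ^\<^sub>m k) + mat_trace (D ^\<^sub>m k)"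
      unfolding F using D by (intro mat_trace_four_block) auto
    finally show ?thesis unfolding xk es(2) by (simp add: mat_trace_def)
  qed
  moreover have "det T = prod_list (x # es)"
  proof -
    have "det T = det ?B" using sim by (intro det_similar) (auto simp: similar_mat_def)
    also have "\<dots> = det ?x * det D"
      using E D by (intro det_four_block_mat_lower_left_zero) auto
    finally show ?thesis using es(1) by (simp add: det_single)
  qed
  ultimately show ?case by blast
qed

text \<open>A Vandermonde argument without matrices: the functional sending p to the sum of
  \<open>m x * p(x)\<close> kills all powers, hence all polynomials. On the polynomial with root set
  \<open>S - {z}\<close> it is a nonzero multiple of \<open>m z\<close>.\<close>

lemma power_sums_eq_0_imp_weights_eq_0:
  fixes m :: "'k::field \<Rightarrow> 'k"
  assumes S: "finite S" and sums: "\<And>k. (\<Sum>x\<in>S. m x * x ^ k) = 0" and z: "z \<in> S"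
  shows "m z = 0"
proof -
  have "(\<Sum>x\<in>S. m x * poly p x) = 0" for p
  proof -
    have "(\<Sum>x\<in>S. m x * poly p x) = (\<Sum>i\<le>degree p. coeff p i * (\<Sum>x\<in>S. m x * x ^ i))"
      unfolding poly_altdef sum_distrib_left by (subst sum.swap) (simp add: algebra_simps)
    then show ?thesis by (simp add: sums)
  qed
  from this[of "\<Prod>y\<in>S - {z}. [:- y, 1:]"]
  have "(\<Sum>x\<in>S. m x * (\<Prod>y\<in>S - {z}. x - y)) = 0" by (simp add: poly_prod)
  also have "(\<Sum>x\<in>S. m x * (\<Prod>y\<in>S - {z}. x - y)) = (\<Sum>x\<in>S. if x = z then m z * (\<Prod>y\<in>S - {z}. z - y) else 0)"
    using S by (intro sum.cong) auto
  also have "\<dots> = m z * (\<Prod>y\<in>S - {z}. z - y)" using S z by simp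
  finally show ?thesis using S by auto
qed

lemma sum_list_map_count:
  fixes f :: "'a \<Rightarrow> 'k::comm_ring_1"
  assumes "finite S" "set xs \<subseteq> S"
  shows "(\<Sum>x\<leftarrow>xs. f x) = (\<Sum>x\<in>S. of_nat (count_list xs x) * f x)"
  using assms(2)
proof (induction xs)
  case (Cons a xs)
  have "(\<Sum>x\<in>S. of_nat (count_list (a # xs) x) * f x)
      = (\<Sum>x\<in>S. (if x = a then f a else 0) + of_nat (count_list xs x) * f x)"
    by (intro sum.cong) (auto simp: algebra_simps)
  then show ?case using Cons assms(1) by (simp add: sum.distrib)
qed simp

lemma prod_list_count:
  fixes xs :: "'k::comm_monoid_mult list"
  assumes "finite S" "set xs \<subseteq> S"
  shows "prod_list xs = (\<Prod>x\<in>S. x ^ count_list xs x)"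
  using assms(2)
proof (induction xs)
  case (Cons a xs)
  have "(\<Prod>x\<in>S. x ^ count_list (a # xs) x)
      = (\<Prod>x\<in>S. (if x = a then a else 1) * x ^ count_list xs x)"
    by (intro prod.cong) auto
  then show ?case using Cons assms(1) by (simp add: prod.distrib)
qed simp

lemma power_int_sum:
  fixes x :: "'k::field"
  assumes "x \<noteq> 0"
  shows "x powi (\<Sum>i\<in>I. f i) = (\<Prod>i\<in>I. x powi f i)"
  using assms by (induction I rule: infinite_finite_induct) (auto simp: power_int_add)

lemma power_int_prod:
  fixes f :: "'i \<Rightarrow> 'k::field"
  shows "(\<Prod>i\<in>I. f i) powi n = (\<Prod>i\<in>I. f i powi n)"
  by (induction I rule: infinite_finite_induct) (auto simp: power_int_mult_distrib)

text \<open>The weighted traces are power sums over all eigenvalues, so each eigenvalue has total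
  weighted multiplicity zero, and regrouping the product of determinants by eigenvalue leaves only
  zeroth powers. Characteristic zero enters as \<open>char0\<close> because the class of
  \<open>'l\<close> does not include it.\<close>

lemma prod_det_eq_1_if_trace_powers:
  fixes T :: "nat \<Rightarrow> 'l::alg_closed_field mat" and n :: "nat \<Rightarrow> int"
  assumes char0: "\<And>z::int. of_int z = (0::'l) \<Longrightarrow> z = 0"
    and T: "\<And>i. i < N \<Longrightarrow> T i \<in> carrier_mat (d i) (d i)"
    and det: "\<And>i. i < N \<Longrightarrow> det (T i) \<noteq> 0"
    and traces: "\<And>k. (\<Sum>i<N. of_int (n i) * mat_trace (T i ^\<^sub>m k)) = 0"
  shows "(\<Prod>i<N. det (T i) powi n i) = 1"
proof -
  have "\<forall>i<N. \<exists>es. det (T i) = prod_list es \<and> (\<forall>k. mat_trace (T i ^\<^sub>m k) = (\<Sum>x\<leftarrow>es. x ^ k))"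
    using eigenvalue_list_exists[OF T] by blast
  then obtain es where es: "\<And>i. i < N \<Longrightarrow> det (T i) = prod_list (es i)"
    "\<And>i k. i < N \<Longrightarrow> mat_trace (T i ^\<^sub>m k) = (\<Sum>x\<leftarrow>es i. x ^ k)"
    by metis
  define S where "S = (\<Union>i<N. set (es i))"
  have S: "finite S" "\<And>i. i < N \<Longrightarrow> set (es i) \<subseteq> S" unfolding S_def by auto
  have S0: "x \<noteq> 0" if "x \<in> S" for x
    using that det es(1) unfolding S_def by (auto simp: prod_list_zero_iff)
  define m where "m x = (\<Sum>i<N. int (count_list (es i) x) * n i)" for x
  have "(\<Sum>x\<in>S. of_int (m x) * x ^ k) = 0" for k
  proof -
    have "(\<Sum>x\<in>S. of_int (m x) * x ^ k)
        = (\<Sum>i<N. of_int (n i) * (\<Sum>x\<in>S. of_nat (count_list (es i) x) * x ^ k))"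
      unfolding m_def of_int_sum sum_distrib_left sum_distrib_right
      by (subst sum.swap) (simp add: algebra_simps)
    also have "\<dots> = (\<Sum>i<N. of_int (n i) * mat_trace (T i ^\<^sub>m k))"
      by (intro sum.cong) (auto simp: es(2) sum_list_map_count[OF S(1) S(2)])
    finally show ?thesis using traces by simp
  qed
  \<comment> \<open>The weights vanish first as elements of the field; \<open>char0\<close> turns
    this into vanishing integers.\<close>
  then have m0: "m x = 0" if "x \<in> S" for x
    by (intro char0) (rule power_sums_eq_0_imp_weights_eq_0[OF S(1) _ that, of "\<lambda>x. of_int (m x)"])
  have "(\<Prod>i<N. det (T i) powi n i) = (\<Prod>i<N. \<Prod>x\<in>S. x powi (int (count_list (es i) x) * n i))"
    using es(1) prod_list_count[OF S(1) S(2)]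
    by (intro prod.cong) (auto simp: power_int_prod power_int_mult)
  also have "\<dots> = (\<Prod>x\<in>S. x powi m x)"
    unfolding m_def using S0 by (subst prod.swap) (intro prod.cong, auto simp: power_int_sum)
  also have "\<dots> = 1" using m0 by simp
  finally show ?thesis .
qed

section \<open>Permutation characters of a relation\<close>

text \<open>The cardinality of this set is the value at \<open>g\<close> of the permutation
  character of G/H.\<close>

definition fixed_cosets :: "('a, 'b) monoid_scheme \<Rightarrow> 'a set \<Rightarrow> 'a \<Rightarrow> 'a set set" where
  "fixed_cosets G H g = {C \<in> lcosets G H. g <#\<^bsub>G\<^esub> C = C}"

context group
begin

lemma l_coset_self:
  assumes "x \<in> carrier G" "subgroup H G"
  shows "x \<in> x <# H"
  using assms subgroup.one_closed[OF assms(2)] unfolding l_coset_def by force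

lemma l_coset_lcosets:
  assumes "subgroup H G" "g \<in> carrier G" "C \<in> lcosets G H"
  shows "g <# C \<in> lcosets G H"
  using assms lcos_m_assoc[OF subgroup.subset[OF assms(1)]] unfolding lcosets_def by auto

lemma l_coset_inv_cancel:
  assumes "subgroup H G" "g \<in> carrier G" "C \<in> lcosets G H"
  shows "g <# (inv g <# C) = C" "inv g <# (g <# C) = C"
proof -
  have "C \<subseteq> carrier G"
    using assms l_coset_subset_G[OF subgroup.subset[OF assms(1)]] unfolding lcosets_def by auto
  then show "g <# (inv g <# C) = C" "inv g <# (g <# C) = C"
    using assms by (simp_all add: lcos_m_assoc lcos_mult_one)
qed

text \<open>The coset xH is fixed by \<open>g\<close> exactly when the conjugate of \<open>g\<close>
  by x lies in \<open>H\<close>. The fixed cosets therefore partition the set of such x into blocks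
  of size |H|.\<close>

lemma card_fixed_cosets:
  assumes fin: "finite (carrier G)" and H: "subgroup H G" and g: "g \<in> carrier G"
  shows "card H * card (fixed_cosets G H g) = card {x \<in> carrier G. inv x \<otimes> g \<otimes> x \<in> H}"
proof -
  note sub = subgroup.subset[OF H]
  have coset_iff: "g <# (x <# H) = x <# H \<longleftrightarrow> inv x \<otimes> g \<otimes> x \<in> H" if x: "x \<in> carrier G" for x
  proof
    assume "g <# (x <# H) = x <# H"
    then have "(g \<otimes> x) <# H = x <# H" using lcos_m_assoc[OF sub g x] by simp
    then have "g \<otimes> x \<in> x <# H" using l_coset_self[OF _ H, of "g \<otimes> x"] g x by simp
    then obtain h where h: "h \<in> H" "g \<otimes> x = x \<otimes> h" unfolding l_coset_def by auto
    then have "inv x \<otimes> g \<otimes> x = h"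
      using g x sub by (metis inv_closed inv_solve_left m_assoc m_closed subsetD)
    then show "inv x \<otimes> g \<otimes> x \<in> H" using h by simp
  next
    assume h: "inv x \<otimes> g \<otimes> x \<in> H"
    have "g \<otimes> x = x \<otimes> (inv x \<otimes> g \<otimes> x)"
      using g x by (simp add: m_assoc[symmetric])
    then have "g \<otimes> x \<in> x <# H" unfolding l_coset_def using h by auto
    then have "x <# H = (g \<otimes> x) <# H" by (rule l_repr_independence[OF _ x H])
    then show "g <# (x <# H) = x <# H" using lcos_m_assoc[OF sub g x] by simp
  qed
  have union: "\<Union> (fixed_cosets G H g) = {x \<in> carrier G. inv x \<otimes> g \<otimes> x \<in> H}"
  proof (intro equalityI subsetI)
    fix x assume "x \<in> \<Union> (fixed_cosets G H g)"
    then obtain a where a: "a \<in> carrier G" "x \<in> a <# H" "g <# (a <# H) = a <# H"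
      unfolding fixed_cosets_def lcosets_def by auto
    then have "x \<in> carrier G" "a <# H = x <# H"
      using l_coset_carrier[OF a(2,1) H] l_repr_independence[OF a(2,1) H] by auto
    then show "x \<in> {x \<in> carrier G. inv x \<otimes> g \<otimes> x \<in> H}" using a(3) coset_iff by auto
  next
    fix x assume "x \<in> {x \<in> carrier G. inv x \<otimes> g \<otimes> x \<in> H}"
    then show "x \<in> \<Union> (fixed_cosets G H g)"
      using coset_iff l_coset_self[OF _ H] unfolding fixed_cosets_def lcosets_def by blast
  qed
  have "card H * card (fixed_cosets G H g) = card (\<Union> (fixed_cosets G H g))"
  proof (rule card_partition)
    show "finite (\<Union> (fixed_cosets G H g))" unfolding union using fin by simp
    then show "finite (fixed_cosets G H g)" by (rule finite_UnionD)
    show "card C = card H" if C: "C \<in> fixed_cosets G H g" for C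
    proof -
      obtain a where a: "a \<in> carrier G" "C = a <# H"
        using C unfolding fixed_cosets_def lcosets_def by auto
      have "C = (\<lambda>h. a \<otimes> h) ` H" unfolding a l_coset_def by auto
      moreover have "inj_on (\<lambda>h. a \<otimes> h) H" using inj_on_cmult[OF a(1)] sub by (rule inj_on_subset)
      ultimately show ?thesis by (simp add: card_image)
    qed
    show "C \<inter> D = {}" if CD: "C \<in> fixed_cosets G H g" "D \<in> fixed_cosets G H g" "C \<noteq> D" for C D
    proof (rule ccontr)
      assume "C \<inter> D \<noteq> {}"
      then obtain x where x: "x \<in> C" "x \<in> D" by auto
      obtain a b where ab: "a \<in> carrier G" "C = a <# H" "b \<in> carrier G" "D = b <# H"
        using CD unfolding fixed_cosets_def lcosets_def by auto
      have "C = x <# H" using l_repr_independence[OF _ ab(1) H, of x] x(1) unfolding ab(2) by simp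
      moreover have "D = x <# H" using l_repr_independence[OF _ ab(3) H, of x] x(2) unfolding ab(4) by simp
      ultimately show False using CD by simp
    qed
  qed
  then show ?thesis unfolding union .
qed

section \<open>Fixed points in the two G-sets of a relation\<close>

context
  fixes \<Theta> :: "('a set \<times> int) list"
  assumes sub: "\<And>i. i < length \<Theta> \<Longrightarrow> subgroup (fst (\<Theta> ! i)) G"
    and fin: "finite (carrier G)"
begin

lemma rel_gset_eq_Sigma:
  "rel_gset G \<Theta> pos = (SIGMA i:{i. i < length \<Theta> \<and> (if pos then snd (\<Theta> ! i) > 0 else snd (\<Theta> ! i) < 0)}.
     {..<nat \<bar>snd (\<Theta> ! i)\<bar>} \<times> lcosets G (fst (\<Theta> ! i)))"
  unfolding rel_gset_def by auto

lemma finite_lcosets: "finite (lcosets G H)"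
  unfolding lcosets_def using fin by simp

lemma finite_rel_gset: "finite (rel_gset G \<Theta> pos)"
  unfolding rel_gset_eq_Sigma by (intro finite_SigmaI) (auto simp: finite_lcosets)

lemma gset_act_closed:
  assumes "g \<in> carrier G" "x \<in> rel_gset G \<Theta> pos"
  shows "gset_act G g x \<in> rel_gset G \<Theta> pos"
  using assms l_coset_lcosets[OF sub] unfolding rel_gset_def gset_act_def by auto

lemma gset_act_inv_cancel:
  assumes "g \<in> carrier G" "x \<in> rel_gset G \<Theta> pos"
  shows "gset_act G g (gset_act G (inv g) x) = x" "gset_act G (inv g) (gset_act G g x) = x"
  using assms l_coset_inv_cancel[OF sub] unfolding rel_gset_def gset_act_def by auto

text \<open>Each part of the relation contains |n_i| copies of G/H_i, so its permutation character
  is the corresponding sum of the characters of the G/H_i.\<close>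

lemma card_fixed_points_rel_gset:
  "card {x \<in> rel_gset G \<Theta> pos. gset_act G g x = x}
    = (\<Sum>i<length \<Theta>. if (if pos then snd (\<Theta> ! i) > 0 else snd (\<Theta> ! i) < 0)
        then nat \<bar>snd (\<Theta> ! i)\<bar> * card (fixed_cosets G (fst (\<Theta> ! i)) g) else 0)"
proof -
  let ?I = "{i. i < length \<Theta> \<and> (if pos then snd (\<Theta> ! i) > 0 else snd (\<Theta> ! i) < 0)}"
  have "{x \<in> rel_gset G \<Theta> pos. gset_act G g x = x}
      = (SIGMA i:?I. {..<nat \<bar>snd (\<Theta> ! i)\<bar>} \<times> fixed_cosets G (fst (\<Theta> ! i)) g)"
    unfolding rel_gset_eq_Sigma fixed_cosets_def gset_act_def by auto
  moreover have "finite (fixed_cosets G H g)" for H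
    unfolding fixed_cosets_def using finite_lcosets by simp
  ultimately have "card {x \<in> rel_gset G \<Theta> pos. gset_act G g x = x}
      = (\<Sum>i\<in>?I. nat \<bar>snd (\<Theta> ! i)\<bar> * card (fixed_cosets G (fst (\<Theta> ! i)) g))"
    by (simp add: card_SigmaI card_cartesian_product)
  also have "\<dots> = (\<Sum>i<length \<Theta>. if (if pos then snd (\<Theta> ! i) > 0 else snd (\<Theta> ! i) < 0)
        then nat \<bar>snd (\<Theta> ! i)\<bar> * card (fixed_cosets G (fst (\<Theta> ! i)) g) else 0)"
    by (rule sum.mono_neutral_cong_left) auto
  finally show ?thesis .
qed

lemma G_relation_card_fixed_points:
  assumes rel: "G_relation G \<Theta>" and g: "g \<in> carrier G"
  shows "card {x \<in> rel_gset G \<Theta> True. gset_act G g x = x}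
    = card {y \<in> rel_gset G \<Theta> False. gset_act G g y = y}"
proof -
  let ?X = "rel_gset G \<Theta> True" and ?Y = "rel_gset G \<Theta> False"
  let ?g = "gset_act G g" and ?h = "gset_act G (inv g)"
  obtain M N :: "nat \<times> nat \<times> 'a set \<Rightarrow> nat \<times> nat \<times> 'a set \<Rightarrow> complex" where
    MN_NM: "\<forall>y\<in>?Y. \<forall>y'\<in>?Y. (\<Sum>x\<in>?X. M y x * N x y') = (if y = y' then 1 else 0)"
      "\<forall>x\<in>?X. \<forall>x'\<in>?X. (\<Sum>y\<in>?Y. N x y * M y x') = (if x = x' then 1 else 0)"
    and equiv: "\<forall>g\<in>carrier G. \<forall>y\<in>?Y. \<forall>x\<in>?X. M (gset_act G g y) (gset_act G g x) = M y x"
    using rel unfolding G_relation_def Let_def by (elim conjE exE) (rule that)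
  note MN = MN_NM(1)[rule_format] and NM = MN_NM(2)[rule_format]
  \<comment> \<open>The trace of \<open>g\<close> on either permutation module counts fixed points, and \<open>M\<close>, \<open>N\<close> conjugate one into the other.\<close>
  have count: "(\<Sum>x\<in>A. if P x then 1 else 0) = (of_nat (card {x \<in> A. P x}) :: complex)"
    if "finite A" for A and P :: "nat \<times> nat \<times> 'a set \<Rightarrow> bool"
    using that by (simp flip: sum.inter_filter)
  have "of_nat (card {x \<in> ?X. ?g x = x}) = (\<Sum>x\<in>?X. if x = ?g x then 1 else (0::complex))"
    by (subst count[OF finite_rel_gset]) (metis (no_types, lifting))
  also have "\<dots> = (\<Sum>x\<in>?X. \<Sum>y\<in>?Y. N x y * M y (?g x))"
    by (intro sum.cong refl) (simp add: NM gset_act_closed[OF g])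
  \<comment> \<open>Equivariance moves \<open>g\<close> from the column index of \<open>M\<close> to
    the row index, where it acts as its inverse. This lets the product of \<open>M\<close> and
    \<open>N\<close> be contracted in the other order.\<close>
  also have "\<dots> = (\<Sum>x\<in>?X. \<Sum>y\<in>?Y. M (?h y) x * N x y)"
  proof (intro sum.cong refl)
    fix x y assume x: "x \<in> ?X" and y: "y \<in> ?Y"
    have "M (?g (?h y)) (?g x) = M (?h y) x"
      using x y g by (intro equiv[rule_format] gset_act_closed) auto
    then show "N x y * M y (?g x) = M (?h y) x * N x y"
      using gset_act_inv_cancel(1)[OF g y] by (simp add: mult.commute)
  qed
  also have "\<dots> = (\<Sum>y\<in>?Y. \<Sum>x\<in>?X. M (?h y) x * N x y)" by (rule sum.swap)
  also have "\<dots> = (\<Sum>y\<in>?Y. if ?h y = y then 1 else 0)"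
    using g by (intro sum.cong refl) (simp add: MN gset_act_closed)
  also have "\<dots> = of_nat (card {y \<in> ?Y. ?h y = y})" by (rule count[OF finite_rel_gset])
  \<comment> \<open>A group element and its inverse fix the same points.\<close>
  also have "{y \<in> ?Y. ?h y = y} = {y \<in> ?Y. ?g y = y}"
    using gset_act_inv_cancel[OF g] by (metis (no_types, lifting))
  finally show ?thesis by (simp only: of_nat_eq_iff)
qed

text \<open>Each coefficient is its positive part minus its negative part, so the sum is the
  difference of the two permutation characters at \<open>g\<close>, which agree in a
  relation.\<close>

lemma G_relation_sum_card_fixed_cosets:
  assumes rel: "G_relation G \<Theta>" and g: "g \<in> carrier G"
  shows "(\<Sum>i<length \<Theta>. snd (\<Theta> ! i) * int (card (fixed_cosets G (fst (\<Theta> ! i)) g))) = 0"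
proof -
  have "(\<Sum>i<length \<Theta>. snd (\<Theta> ! i) * int (card (fixed_cosets G (fst (\<Theta> ! i)) g)))
      = int (card {x \<in> rel_gset G \<Theta> True. gset_act G g x = x})
        - int (card {y \<in> rel_gset G \<Theta> False. gset_act G g y = y})"
    unfolding card_fixed_points_rel_gset of_nat_sum sum_subtractf[symmetric]
    by (intro sum.cong) auto
  then show ?thesis using G_relation_card_fixed_points[OF assms] by simp
qed

text \<open>By Frobenius reciprocity the mean of a class function over \<open>H\<close> is its inner
  product with the permutation character of G/H. The weighted sum of these characters vanishes at
  every element of the group.\<close>

lemma G_relation_sum_class_function:
  fixes f :: "'a \<Rightarrow> 'k::field_char_0"
  assumes rel: "G_relation G \<Theta>"
    and class_fun: "\<And>x g. x \<in> carrier G \<Longrightarrow> g \<in> carrier G \<Longrightarrow> f (inv x \<otimes> g \<otimes> x) = f g"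
  shows "(\<Sum>i<length \<Theta>. of_int (snd (\<Theta> ! i)) *
    ((\<Sum>h\<in>fst (\<Theta> ! i). f h) / of_nat (card (fst (\<Theta> ! i))))) = 0"
proof -
  have mean: "(\<Sum>h\<in>H. f h) / of_nat (card H)
      = (\<Sum>g\<in>carrier G. f g * of_nat (card (fixed_cosets G H g))) / of_nat (card (carrier G))"
    if H: "subgroup H G" for H
  proof -
    \<comment> \<open>Conjugating by x does not change the sum over \<open>H\<close>, so it may be
      summed over all x. After exchanging the sums, \<open>g\<close> occurs once for every x with
      conjugate in \<open>H\<close>, which is |H| times the number of fixed cosets.\<close>
    have "of_nat (card (carrier G)) * (\<Sum>h\<in>H. f h) = (\<Sum>x\<in>carrier G. \<Sum>h\<in>H. f h)" by simp
    also have "\<dots> = (\<Sum>x\<in>carrier G. \<Sum>g\<in>carrier G. if inv x \<otimes> g \<otimes> x \<in> H then f g else 0)"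
    proof (rule sum.cong[OF refl])
      fix x assume x: "x \<in> carrier G"
      have "(\<Sum>h\<in>H. f h) = (\<Sum>g\<in>{g \<in> carrier G. inv x \<otimes> g \<otimes> x \<in> H}. f g)"
      proof (rule sum.reindex_bij_witness[of _ "\<lambda>g. inv x \<otimes> g \<otimes> x" "\<lambda>h. x \<otimes> h \<otimes> inv x"])
        fix h assume h: "h \<in> H"
        then have hG: "h \<in> carrier G" using subgroup.subset[OF H] by auto
        have eq: "inv x \<otimes> (x \<otimes> h \<otimes> inv x) \<otimes> x = h"
          using x hG by (simp add: m_assoc) (simp add: m_assoc[symmetric])
        show "inv x \<otimes> (x \<otimes> h \<otimes> inv x) \<otimes> x = h" by (rule eq)
        show "x \<otimes> h \<otimes> inv x \<in> {g \<in> carrier G. inv x \<otimes> g \<otimes> x \<in> H}"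
          using eq h x hG by simp
        show "f (x \<otimes> h \<otimes> inv x) = f h"
          using class_fun[OF x, of "x \<otimes> h \<otimes> inv x"] eq x hG by simp
      next
        fix g assume "g \<in> {g \<in> carrier G. inv x \<otimes> g \<otimes> x \<in> H}"
        then show "inv x \<otimes> g \<otimes> x \<in> H" and "x \<otimes> (inv x \<otimes> g \<otimes> x) \<otimes> inv x = g"
          using x by (simp, simp add: m_assoc) (simp add: m_assoc[symmetric])
      qed
      then show "(\<Sum>h\<in>H. f h) = (\<Sum>g\<in>carrier G. if inv x \<otimes> g \<otimes> x \<in> H then f g else 0)"
        using fin by (simp add: sum.inter_filter)
    qed
    also have "\<dots> = (\<Sum>g\<in>carrier G. \<Sum>x\<in>carrier G. if inv x \<otimes> g \<otimes> x \<in> H then f g else 0)"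
      by (rule sum.swap)
    also have "\<dots> = (\<Sum>g\<in>carrier G. of_nat (card H) * (f g * of_nat (card (fixed_cosets G H g))))"
    proof (rule sum.cong[OF refl])
      fix g assume g: "g \<in> carrier G"
      have "(\<Sum>x\<in>carrier G. if inv x \<otimes> g \<otimes> x \<in> H then f g else 0)
          = of_nat (card {x \<in> carrier G. inv x \<otimes> g \<otimes> x \<in> H}) * f g"
        using fin by (simp flip: sum.inter_filter)
      then show "(\<Sum>x\<in>carrier G. if inv x \<otimes> g \<otimes> x \<in> H then f g else 0)
          = of_nat (card H) * (f g * of_nat (card (fixed_cosets G H g)))"
        by (simp flip: card_fixed_cosets[OF fin H g])
    qed
    finally have "of_nat (card (carrier G)) * (\<Sum>h\<in>H. f h)
        = of_nat (card H) * (\<Sum>g\<in>carrier G. f g * of_nat (card (fixed_cosets G H g)))"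
      by (simp add: sum_distrib_left)
    moreover have "of_nat (card (carrier G)) \<noteq> (0::'k)" "of_nat (card H) \<noteq> (0::'k)"
      using fin subgroup.subset[OF H] subgroup.one_closed[OF H] by (auto simp: card_eq_0_iff dest: finite_subset)
    ultimately show ?thesis by (simp add: field_simps)
  qed
  have "(\<Sum>i<length \<Theta>. of_int (snd (\<Theta> ! i)) * ((\<Sum>h\<in>fst (\<Theta> ! i). f h) / of_nat (card (fst (\<Theta> ! i)))))
      = (\<Sum>i<length \<Theta>. \<Sum>g\<in>carrier G. of_int (snd (\<Theta> ! i))
          * (f g * of_nat (card (fixed_cosets G (fst (\<Theta> ! i)) g))) / of_nat (card (carrier G)))"
    by (intro sum.cong refl, simp only: mean[OF sub] lessThan_iff)
      (simp add: sum_distrib_left sum_divide_distrib)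
  also have "\<dots> = (\<Sum>g\<in>carrier G. f g / of_nat (card (carrier G))
      * of_int (\<Sum>i<length \<Theta>. snd (\<Theta> ! i) * int (card (fixed_cosets G (fst (\<Theta> ! i)) g))))"
    unfolding of_int_sum sum_distrib_left by (subst sum.swap) (simp add: algebra_simps)
  also have "\<dots> = 0" using G_relation_sum_card_fixed_cosets[OF rel] by simp
  finally show ?thesis .
qed

end

end

section \<open>Descent of the alternating pairing\<close>

lemma comm_ring_hom_field_embedding:
  assumes "field_embedding e"
  shows "comm_ring_hom e"
proof -
  have "e 0 = 0" using assms unfolding field_embedding_def by (metis add_cancel_right_left)
  then show ?thesis using assms unfolding field_embedding_def by unfold_locales auto
qed

text \<open>The matrix is affine, not linear, in the coefficients so that \<open>N\<close> can
  absorb those already chosen in the subfield; this is why \<open>N\<close> varies in the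
  induction.\<close>

lemma det_nonzero_descent:
  fixes e :: "'k::field_char_0 \<Rightarrow> 'l::field"
  assumes e: "field_embedding e" and "finite I"
    and "det (mat n n (\<lambda>(r, s). e (N r s) + (\<Sum>i\<in>I. a i * e (M i r s)))) \<noteq> 0"
  shows "\<exists>c. det (mat n n (\<lambda>(r, s). N r s + (\<Sum>i\<in>I. c i * M i r s))) \<noteq> 0"
  using assms(2,3)
proof (induction I arbitrary: N rule: finite_induct)
  case empty
  interpret comm_ring_hom e using e by (rule comm_ring_hom_field_embedding)
  have "mat n n (\<lambda>(r, s). e (N r s)) = map_mat e (mat n n (\<lambda>(r, s). N r s))" by auto
  then show ?case using empty by auto
next
  case (insert j I)
  \<comment> \<open>One coefficient at a time is moved into the subfield: \<open>det R\<close> is a nonzero polynomial in the coefficient of \<open>M j\<close>.\<close>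
  define R where "R = mat n n (\<lambda>(r, s). [:e (N r s) + (\<Sum>i\<in>I. a i * e (M i r s)), e (M j r s):])"
  have poly_det: "poly (det R) x
      = det (mat n n (\<lambda>(r, s). e (N r s) + x * e (M j r s) + (\<Sum>i\<in>I. a i * e (M i r s))))" for x
  proof -
    have hom: "comm_ring_hom (\<lambda>p. poly p x)" by unfold_locales auto
    have "map_mat (\<lambda>p. poly p x) R
        = mat n n (\<lambda>(r, s). e (N r s) + x * e (M j r s) + (\<Sum>i\<in>I. a i * e (M i r s)))"
      unfolding R_def by (auto simp: algebra_simps)
    then show ?thesis using comm_ring_hom.hom_det[OF hom, of R] by simp
  qed
  have "poly (det R) (a j) \<noteq> 0"
    using insert.prems insert.hyps unfolding poly_det by (simp add: add.assoc)
  then have "det R \<noteq> 0" by auto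
  then have "finite {x. poly (det R) x = 0}" by (rule poly_roots_finite)
  \<comment> \<open>The subfield is infinite, so it contains an element outside the finite set of
    roots.\<close>
  moreover have "infinite (range e)"
    using e infinite_UNIV_char_0[where 'a = 'k] unfolding field_embedding_def
    by (simp add: finite_image_iff)
  ultimately have "\<not> range e \<subseteq> {x. poly (det R) x = 0}" using finite_subset by blast
  then obtain c where c: "poly (det R) (e c) \<noteq> 0" by auto
  have "det (mat n n (\<lambda>(r, s). e (N r s + c * M j r s) + (\<Sum>i\<in>I. a i * e (M i r s)))) \<noteq> 0"
    using c e unfolding poly_det field_embedding_def by simp
  then obtain c' where c': "det (mat n n (\<lambda>(r, s). N r s + c * M j r s + (\<Sum>i\<in>I. c' i * M i r s))) \<noteq> 0"
    using insert.IH[of "\<lambda>r s. N r s + c * M j r s"] by blast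
  have "(\<Sum>i\<in>insert j I. (c'(j := c)) i * M i r s) = c * M j r s + (\<Sum>i\<in>I. c' i * M i r s)" for r s
    using insert.hyps by (auto intro!: sum.cong)
  then show ?case using c' by (intro exI[of _ "c'(j := c)"]) (simp add: add.assoc)
qed

lemma index_congruence_mat:
  assumes "A \<in> carrier_mat n n" "R \<in> carrier_mat n n" "r < n" "s < n"
  shows "(transpose_mat R * A * R) $$ (r, s) = (\<Sum>q<n. \<Sum>p<n. R $$ (p, r) * A $$ (p, q) * R $$ (q, s))"
proof -
  have "(transpose_mat R * A * R) $$ (r, s) = (\<Sum>q<n. (transpose_mat R * A) $$ (r, q) * R $$ (q, s))"
    using assms by (intro index_mult_mat_sum[of _ n n]) auto
  also have "\<dots> = (\<Sum>q<n. \<Sum>p<n. R $$ (p, r) * A $$ (p, q) * R $$ (q, s))"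
  proof (rule sum.cong[OF refl])
    fix q assume "q \<in> {..<n}"
    then have "(transpose_mat R * A) $$ (r, q) = (\<Sum>p<n. transpose_mat R $$ (r, p) * A $$ (p, q))"
      using assms by (intro index_mult_mat_sum[of _ n n]) auto
    also have "\<dots> = (\<Sum>p<n. R $$ (p, r) * A $$ (p, q))"
      using assms by (intro sum.cong) auto
    finally show "(transpose_mat R * A) $$ (r, q) * R $$ (q, s)
        = (\<Sum>p<n. R $$ (p, r) * A $$ (p, q) * R $$ (q, s))"
      by (simp add: sum_distrib_right)
  qed
  finally show ?thesis .
qed

text \<open>Polarisation on the sum of two unit vectors.\<close>

lemma alternating_imp_skew:
  fixes A :: "'k::field mat"
  assumes A: "A \<in> carrier_mat n n" and alt: "alternating n A" and ij: "i < n" "j < n"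
  shows "A $$ (j, i) = - A $$ (i, j)"
proof -
  have entry: "unit_vec n r \<bullet> (A *\<^sub>v unit_vec n s) = A $$ (r, s)" if "r < n" "s < n" for r s
    using A that by simp
  let ?u = "unit_vec n i" and ?v = "unit_vec n j"
  have "0 = (?u + ?v) \<bullet> (A *\<^sub>v (?u + ?v))"
    using alt unfolding alternating_def by simp
  also have "\<dots> = ?u \<bullet> (A *\<^sub>v ?u) + ?u \<bullet> (A *\<^sub>v ?v) + ?v \<bullet> (A *\<^sub>v ?u) + ?v \<bullet> (A *\<^sub>v ?v)"
    using A by (simp add: mult_add_distrib_mat_vec[of _ n n] add_scalar_prod_distrib[of _ n]
        scalar_prod_add_distrib[of _ n])
  also have "\<dots> = A $$ (i, j) + A $$ (j, i)"
    using alt entry ij unfolding alternating_def by simp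
  finally show ?thesis by (simp add: eq_neg_iff_add_eq_0 add.commute)
qed

text \<open>The skew invariant matrices \<open>m i j\<close> are defined over the small field, and
  over the large field they combine to a nonzero multiple of \<open>A\<close>. Since some
  combination is nondegenerate over the large field, one with coefficients in the small field is
  nondegenerate too.\<close>

lemma (in group) skew_invariant_pairing_descent:
  fixes \<rho> :: "'a \<Rightarrow> 'k::field_char_0 mat" and e :: "'k \<Rightarrow> 'l::field"
  assumes fin: "finite (carrier G)" and rep: "is_rep G n \<rho>" and e: "field_embedding e"
    and pairing: "invariant_pairing G n (\<lambda>g. map_mat e (\<rho> g)) A" and alt: "alternating n A"
  shows "\<exists>C. invariant_pairing G n \<rho> C \<and> (\<forall>i<n. \<forall>j<n. C $$ (j, i) = - C $$ (i, j))"
proof -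
  interpret e: comm_ring_hom e using e by (rule comm_ring_hom_field_embedding)
  have A: "A \<in> carrier_mat n n" "det A \<noteq> 0"
    using pairing unfolding invariant_pairing_def by auto
  note skewA = alternating_imp_skew[OF A(1) alt]
  have \<rho>: "\<rho> g \<in> carrier_mat n n" if "g \<in> carrier G" for g
    using rep that unfolding is_rep_def by auto
  \<comment> \<open>With E_ij the elementary matrix, \<open>m i j\<close> is the sum over g of
    \<open>transpose_mat (\<rho> g) * (E_ij - E_ji) * \<rho> g\<close>, the unnormalised average of
    a skew matrix.\<close>
  define m where "m i j r s = (\<Sum>g\<in>carrier G. \<rho> g $$ (i, r) * \<rho> g $$ (j, s) - \<rho> g $$ (j, r) * \<rho> g $$ (i, s))"
    for i j r s
  let ?I = "{..<n} \<times> {..<n}"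
  let ?N = "of_nat (2 * card (carrier G)) :: 'l"
  \<comment> \<open>Nonvanishing of 2|G| in the large field is carried over from the small field,
    which has characteristic zero.\<close>
  have "?N \<noteq> 0"
  proof -
    have "?N = e (of_nat (2 * card (carrier G)))" by (rule e.hom_of_nat[symmetric])
    moreover have "card (carrier G) \<noteq> 0" using fin by auto
    then have "of_nat (2 * card (carrier G)) \<noteq> (0::'k)" by (simp only: of_nat_eq_0_iff)
    ultimately show ?thesis using e unfolding field_embedding_def by (metis e.hom_zero injD)
  qed
  \<comment> \<open>Averaging \<open>A\<close> minus its transpose: invariance contributes the
    factor |G| and skewness the factor 2.\<close>
  have avg: "(\<Sum>q<n. \<Sum>p<n. A $$ (p, q) * e (m p q r s)) = ?N * A $$ (r, s)" if rs: "r < n" "s < n" for r s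
  proof -
    have inv: "(\<Sum>q<n. \<Sum>p<n. e (\<rho> g $$ (p, r)) * A $$ (p, q) * e (\<rho> g $$ (q, s))) = A $$ (r, s)"
      if "g \<in> carrier G" "r < n" "s < n" for g r s
    proof -
      have "transpose_mat (map_mat e (\<rho> g)) * A * map_mat e (\<rho> g) = A"
        using pairing that unfolding invariant_pairing_def by auto
      then have "A $$ (r, s)
          = (\<Sum>q<n. \<Sum>p<n. map_mat e (\<rho> g) $$ (p, r) * A $$ (p, q) * map_mat e (\<rho> g) $$ (q, s))"
        using index_congruence_mat[OF A(1), of "map_mat e (\<rho> g)" r s] \<rho>[OF that(1)] that by simp
      then show ?thesis using \<rho>[OF that(1)] that by (simp add: carrier_matD)
    qed
    have "(\<Sum>q<n. \<Sum>p<n. A $$ (p, q) * e (m p q r s))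
        = (\<Sum>g\<in>carrier G. (\<Sum>q<n. \<Sum>p<n. e (\<rho> g $$ (p, r)) * A $$ (p, q) * e (\<rho> g $$ (q, s)))
          - (\<Sum>q<n. \<Sum>p<n. e (\<rho> g $$ (p, s)) * A $$ (p, q) * e (\<rho> g $$ (q, r))))"
    proof -
      have "(\<Sum>q<n. \<Sum>p<n. A $$ (p, q) * e (m p q r s))
        = (\<Sum>q<n. \<Sum>p<n. \<Sum>g\<in>carrier G. e (\<rho> g $$ (p, r)) * A $$ (p, q) * e (\<rho> g $$ (q, s))
          - e (\<rho> g $$ (p, s)) * A $$ (p, q) * e (\<rho> g $$ (q, r)))"
        unfolding m_def by (simp add: e.hom_sum e.hom_minus e.hom_mult sum_distrib_left algebra_simps)
      also have "\<dots> = (\<Sum>q<n. \<Sum>g\<in>carrier G. \<Sum>p<n. e (\<rho> g $$ (p, r)) * A $$ (p, q) * e (\<rho> g $$ (q, s))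
          - e (\<rho> g $$ (p, s)) * A $$ (p, q) * e (\<rho> g $$ (q, r)))"
        by (intro sum.cong[OF refl] sum.swap)
      finally show ?thesis by (subst (asm) (2) sum.swap) (simp add: sum_subtractf)
    qed
    also have "\<dots> = (\<Sum>g\<in>carrier G. A $$ (r, s) - A $$ (s, r))"
      by (intro sum.cong[OF refl]) (simp add: inv rs)
    also have "\<dots> = ?N * A $$ (r, s)" using skewA[OF rs] by (simp add: algebra_simps)
    finally show ?thesis .
  qed
  \<comment> \<open>This puts 2|G| times \<open>A\<close> in the form required for descent: constant
    part zero, and coefficient \<open>A $$ (p, q)\<close> at the index pair (p, q).\<close>
  have "mat n n (\<lambda>(r, s). e 0 + (\<Sum>i\<in>?I. A $$ i * e (m (fst i) (snd i) r s))) = ?N \<cdot>\<^sub>m A"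
  proof (rule eq_matI)
    fix r s assume "r < dim_row (?N \<cdot>\<^sub>m A)" "s < dim_col (?N \<cdot>\<^sub>m A)"
    then have rs: "r < n" "s < n" using A by auto
    have "(\<Sum>i\<in>?I. A $$ i * e (m (fst i) (snd i) r s)) = (\<Sum>p<n. \<Sum>q<n. A $$ (p, q) * e (m p q r s))"
      by (simp add: sum.cartesian_product case_prod_beta)
    also have "\<dots> = ?N * A $$ (r, s)" by (subst sum.swap) (rule avg[OF rs])
    finally show "mat n n (\<lambda>(r, s). e 0 + (\<Sum>i\<in>?I. A $$ i * e (m (fst i) (snd i) r s))) $$ (r, s)
        = (?N \<cdot>\<^sub>m A) $$ (r, s)"
      using rs A by simp
  qed (use A in auto)
  moreover have "det (?N \<cdot>\<^sub>m A) \<noteq> 0" using A \<open>?N \<noteq> 0\<close> by simp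
  ultimately have "det (mat n n (\<lambda>(r, s). e 0 + (\<Sum>i\<in>?I. A $$ i * e (m (fst i) (snd i) r s)))) \<noteq> 0"
    by (simp only: not_False_eq_True)
  then have "\<exists>c. det (mat n n (\<lambda>(r, s). 0 + (\<Sum>i\<in>?I. c i * m (fst i) (snd i) r s))) \<noteq> 0"
    by (intro det_nonzero_descent[OF e, where N = "\<lambda>_ _. 0" and a = "\<lambda>i. A $$ i"]) auto
  then obtain c where c: "det (mat n n (\<lambda>(r, s). \<Sum>i\<in>?I. c i * m (fst i) (snd i) r s)) \<noteq> 0" by auto
  define C where "C = mat n n (\<lambda>(r, s). \<Sum>i\<in>?I. c i * m (fst i) (snd i) r s)"
  have C: "C \<in> carrier_mat n n" unfolding C_def by simp
  \<comment> \<open>Congruence by \<open>\<rho> h\<close> replaces g by gh in each summand, which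
    only permutes the sum over the group.\<close>
  have m_inv: "(\<Sum>q<n. \<Sum>p<n. \<rho> h $$ (p, r) * m i j p q * \<rho> h $$ (q, s)) = m i j r s"
    if h: "h \<in> carrier G" and ij: "i < n" "j < n" and rs: "r < n" "s < n" for h i j r s
  proof -
    have prod: "(\<Sum>p<n. \<rho> g $$ (k, p) * \<rho> h $$ (p, t)) = \<rho> (g \<otimes> h) $$ (k, t)"
      if "g \<in> carrier G" "k < n" "t < n" for g k t
      using index_mult_mat_sum[OF \<rho>[OF that(1)] \<rho>[OF h] that(2,3)] rep h that(1)
      unfolding is_rep_def by simp
    have split: "(\<Sum>q<n. \<Sum>p<n. \<rho> h $$ (p, r) * (\<rho> g $$ (k, p) * \<rho> g $$ (l, q)) * \<rho> h $$ (q, s))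
        = \<rho> (g \<otimes> h) $$ (k, r) * \<rho> (g \<otimes> h) $$ (l, s)"
      if "g \<in> carrier G" "k < n" "l < n" for g k l
    proof -
      have "(\<Sum>q<n. \<Sum>p<n. \<rho> h $$ (p, r) * (\<rho> g $$ (k, p) * \<rho> g $$ (l, q)) * \<rho> h $$ (q, s))
          = (\<Sum>p<n. \<rho> g $$ (k, p) * \<rho> h $$ (p, r)) * (\<Sum>q<n. \<rho> g $$ (l, q) * \<rho> h $$ (q, s))"
        unfolding sum_product by (subst sum.swap) (simp add: algebra_simps)
      then show ?thesis using that rs by (simp add: prod)
    qed
    have "(\<Sum>q<n. \<Sum>p<n. \<rho> h $$ (p, r) * m i j p q * \<rho> h $$ (q, s))
        = (\<Sum>q<n. \<Sum>p<n. \<Sum>g\<in>carrier G.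
            \<rho> h $$ (p, r) * (\<rho> g $$ (i, p) * \<rho> g $$ (j, q)) * \<rho> h $$ (q, s)
            - \<rho> h $$ (p, r) * (\<rho> g $$ (j, p) * \<rho> g $$ (i, q)) * \<rho> h $$ (q, s))"
      unfolding m_def by (simp add: sum_distrib_left sum_distrib_right algebra_simps)
    also have "\<dots> = (\<Sum>q<n. \<Sum>g\<in>carrier G. \<Sum>p<n.
            \<rho> h $$ (p, r) * (\<rho> g $$ (i, p) * \<rho> g $$ (j, q)) * \<rho> h $$ (q, s)
            - \<rho> h $$ (p, r) * (\<rho> g $$ (j, p) * \<rho> g $$ (i, q)) * \<rho> h $$ (q, s))"
      by (intro sum.cong[OF refl] sum.swap)
    also have "\<dots> = (\<Sum>g\<in>carrier G. \<Sum>q<n. \<Sum>p<n.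
            \<rho> h $$ (p, r) * (\<rho> g $$ (i, p) * \<rho> g $$ (j, q)) * \<rho> h $$ (q, s)
            - \<rho> h $$ (p, r) * (\<rho> g $$ (j, p) * \<rho> g $$ (i, q)) * \<rho> h $$ (q, s))"
      by (rule sum.swap)
    also have "\<dots> = (\<Sum>g\<in>carrier G. \<rho> (g \<otimes> h) $$ (i, r) * \<rho> (g \<otimes> h) $$ (j, s)
            - \<rho> (g \<otimes> h) $$ (j, r) * \<rho> (g \<otimes> h) $$ (i, s))"
      by (intro sum.cong[OF refl]) (simp only: sum_subtractf split ij)
    also have "\<dots> = m i j r s"
      unfolding m_def
      by (rule sum.reindex_bij_witness[of _ "\<lambda>g. g \<otimes> inv h" "\<lambda>g. g \<otimes> h"])
        (use h in \<open>auto simp: m_assoc\<close>)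
    finally show ?thesis .
  qed
  have "transpose_mat (\<rho> h) * C * \<rho> h = C" if h: "h \<in> carrier G" for h
  proof (rule eq_matI)
    fix r s assume "r < dim_row C" "s < dim_col C"
    then have rs: "r < n" "s < n" using C by auto
    have "(transpose_mat (\<rho> h) * C * \<rho> h) $$ (r, s)
        = (\<Sum>q<n. \<Sum>p<n. \<Sum>i\<in>?I. c i * (\<rho> h $$ (p, r) * m (fst i) (snd i) p q * \<rho> h $$ (q, s)))"
      unfolding index_congruence_mat[OF C \<rho>[OF h] rs]
      by (intro sum.cong[OF refl]) (simp add: C_def sum_distrib_left sum_distrib_right algebra_simps)
    also have "\<dots> = (\<Sum>q<n. \<Sum>i\<in>?I. \<Sum>p<n. c i * (\<rho> h $$ (p, r) * m (fst i) (snd i) p q * \<rho> h $$ (q, s)))"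
      by (intro sum.cong[OF refl] sum.swap)
    also have "\<dots> = (\<Sum>i\<in>?I. \<Sum>q<n. \<Sum>p<n. c i * (\<rho> h $$ (p, r) * m (fst i) (snd i) p q * \<rho> h $$ (q, s)))"
      by (rule sum.swap)
    also have "\<dots> = (\<Sum>i\<in>?I. c i * m (fst i) (snd i) r s)"
      by (intro sum.cong[OF refl]) (auto simp: m_inv[OF h _ _ rs] simp flip: sum_distrib_left)
    finally show "(transpose_mat (\<rho> h) * C * \<rho> h) $$ (r, s) = C $$ (r, s)"
      using rs unfolding C_def by simp
  qed (use C \<rho>[OF h] in auto)
  moreover have "C $$ (s, r) = - C $$ (r, s)" if "r < n" "s < n" for r s
  proof -
    have "m i j s r = - m i j r s" for i j
      unfolding m_def sum_negf[symmetric] by (intro sum.cong) (auto simp: mult.commute)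
    then show ?thesis using that unfolding C_def by (simp flip: sum_negf)
  qed
  ultimately show ?thesis using c C unfolding invariant_pairing_def C_def by blast
qed


section \<open>Restriction to invariants\<close>

definition mat_avg :: "nat \<Rightarrow> nat \<Rightarrow> 'a set \<Rightarrow> ('a \<Rightarrow> 'k::field mat) \<Rightarrow> 'k mat" where
  "mat_avg n m H F = mat n m (\<lambda>(i, j). (\<Sum>h\<in>H. F h $$ (i, j)) / of_nat (card H))"

lemma mat_avg_carrier [simp]: "mat_avg n m H F \<in> carrier_mat n m"
  unfolding mat_avg_def by simp

lemma mat_avg_cong: "(\<And>h. h \<in> H \<Longrightarrow> F h = F' h) \<Longrightarrow> mat_avg n m H F = mat_avg n m H F'"
  unfolding mat_avg_def by auto

lemma mat_avg_reindex:
  assumes "bij_betw b H H"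
  shows "mat_avg n m H (\<lambda>h. F (b h)) = mat_avg n m H F"
proof -
  have "(\<Sum>h\<in>H. F (b h) $$ x) = (\<Sum>h\<in>H. F h $$ x)" for x
    by (rule sum.reindex_bij_betw[OF assms])
  then show ?thesis unfolding mat_avg_def by simp
qed

lemma mat_avg_const:
  fixes X :: "'k::field_char_0 mat"
  assumes "finite H" "H \<noteq> {}" "X \<in> carrier_mat n m"
  shows "mat_avg n m H (\<lambda>_. X) = X"
  using assms unfolding mat_avg_def by (intro eq_matI) auto

lemma mult_mat_avg:
  assumes X: "X \<in> carrier_mat p n" and F: "\<And>h. h \<in> H \<Longrightarrow> F h \<in> carrier_mat n m"
  shows "X * mat_avg n m H F = mat_avg p m H (\<lambda>h. X * F h)"
proof (rule eq_matI)
  fix i j assume "i < dim_row (mat_avg p m H (\<lambda>h. X * F h))" "j < dim_col (mat_avg p m H (\<lambda>h. X * F h))"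
  then have ij: "i < p" "j < m" by (auto simp: mat_avg_def)
  have "(X * mat_avg n m H F) $$ (i, j) = (\<Sum>k<n. \<Sum>h\<in>H. X $$ (i, k) * F h $$ (k, j) / of_nat (card H))"
    unfolding index_mult_mat_sum[OF X mat_avg_carrier ij]
    by (intro sum.cong[OF refl]) (use ij in \<open>simp add: mat_avg_def sum_distrib_left sum_divide_distrib\<close>)
  also have "\<dots> = (\<Sum>h\<in>H. (\<Sum>k<n. X $$ (i, k) * F h $$ (k, j)) / of_nat (card H))"
    by (subst sum.swap) (simp add: sum_divide_distrib)
  also have "\<dots> = (\<Sum>h\<in>H. (X * F h) $$ (i, j) / of_nat (card H))"
    by (intro sum.cong[OF refl]) (simp only: index_mult_mat_sum[OF X F ij])
  finally show "(X * mat_avg n m H F) $$ (i, j) = mat_avg p m H (\<lambda>h. X * F h) $$ (i, j)"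
    using ij by (simp add: mat_avg_def sum_divide_distrib del: index_mult_mat)
qed (use X in \<open>auto simp: mat_avg_def\<close>)

lemma transpose_mat_avg:
  assumes "\<And>h. h \<in> H \<Longrightarrow> F h \<in> carrier_mat n m"
  shows "transpose_mat (mat_avg n m H F) = mat_avg m n H (\<lambda>h. transpose_mat (F h))"
  unfolding mat_avg_def using carrier_matD[OF assms]
  by (intro eq_matI) (auto intro!: sum.cong arg_cong2[of _ _ _ _ "(/)"])

text \<open>The transpose of the rule for multiplication from the left.\<close>

lemma mat_avg_mult:
  fixes X :: "'k::field mat"
  assumes X: "X \<in> carrier_mat m p" and F: "\<And>h. h \<in> H \<Longrightarrow> F h \<in> carrier_mat n m"
  shows "mat_avg n m H F * X = mat_avg n p H (\<lambda>h. F h * X)"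
proof -
  have "transpose_mat (mat_avg n m H F * X) = transpose_mat X * mat_avg m n H (\<lambda>h. transpose_mat (F h))"
    using X by (simp add: transpose_mult[of _ n m _ p] transpose_mat_avg[OF F])
  also have "\<dots> = mat_avg p n H (\<lambda>h. transpose_mat X * transpose_mat (F h))"
    by (rule mult_mat_avg) (use X F in auto)
  also have "\<dots> = mat_avg p n H (\<lambda>h. transpose_mat (F h * X))"
    by (rule mat_avg_cong) (use transpose_mult[OF F X] in simp)
  also have "\<dots> = transpose_mat (mat_avg n p H (\<lambda>h. F h * X))"
    by (rule transpose_mat_avg[symmetric]) (rule mult_carrier_mat[OF F X])
  finally show ?thesis by (metis transpose_transpose)
qed

lemma mat_trace_avg:
  assumes "\<And>h. h \<in> H \<Longrightarrow> F h \<in> carrier_mat n n"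
  shows "mat_trace (mat_avg n n H F) = (\<Sum>h\<in>H. mat_trace (F h)) / of_nat (card H)"
proof -
  have "mat_trace (mat_avg n n H F) = (\<Sum>i<n. \<Sum>h\<in>H. F h $$ (i, i)) / of_nat (card H)"
    unfolding mat_trace_def mat_avg_def by (simp add: sum_divide_distrib)
  also have "(\<Sum>i<n. \<Sum>h\<in>H. F h $$ (i, i)) = (\<Sum>h\<in>H. mat_trace (F h))"
    by (subst sum.swap) (auto simp: mat_trace_def dest!: assms intro!: sum.cong)
  finally show ?thesis .
qed

context group
begin

lemma bij_betw_subgroup_mult:
  assumes H: "subgroup H G" and g: "g \<in> H"
  shows "bij_betw (\<lambda>h. g \<otimes> h) H H"
  by (rule bij_betw_byWitness[of _ "\<lambda>h. inv g \<otimes> h"])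
    (use g subgroup.subset[OF H] subgroup.m_closed[OF H] subgroup.m_inv_closed[OF H]
      in \<open>auto simp: m_assoc[symmetric] subset_iff\<close>)

lemma bij_betw_subgroup_inv:
  assumes H: "subgroup H G"
  shows "bij_betw (\<lambda>h. inv h) H H"
  by (rule bij_betw_byWitness[of _ "\<lambda>h. inv h"])
    (use subgroup.subset[OF H] subgroup.m_inv_closed[OF H] in \<open>auto simp: subset_iff\<close>)

end

section \<open>Coordinates, pairings and endomorphisms on the invariants of a subgroup\<close>

locale finite_group_rep = group G for G (structure) +
  fixes n :: nat and \<rho> :: "'a \<Rightarrow> 'k::field_char_0 mat"
  assumes fin: "finite (carrier G)" and rep: "is_rep G n \<rho>"
begin

lemma rep_carrier: "g \<in> carrier G \<Longrightarrow> \<rho> g \<in> carrier_mat n n"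
  using rep unfolding is_rep_def by blast

lemma rep_mult: "g \<in> carrier G \<Longrightarrow> h \<in> carrier G \<Longrightarrow> \<rho> (g \<otimes> h) = \<rho> g * \<rho> h"
  using rep unfolding is_rep_def by blast

lemma rep_one: "\<rho> \<one> = 1\<^sub>m n"
  using rep unfolding is_rep_def by blast

end

locale subgroup_invariants = finite_group_rep +
  fixes H vs
  assumes H: "subgroup H G" and basis: "is_basis n (invariants G n \<rho> H) vs"
begin

text \<open>The Reynolds operator of \<open>H\<close>, the projection onto the invariants.\<close>

definition "proj = mat_avg n n H \<rho>"
definition "V = mat_of_cols n vs"
abbreviation "d \<equiv> length vs"

lemma proj_carrier: "proj \<in> carrier_mat n n" unfolding proj_def by simp

lemma V_carrier: "V \<in> carrier_mat n d" unfolding V_def by simp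

lemma H_carrier: "h \<in> H \<Longrightarrow> h \<in> carrier G"
  using subgroup.subset[OF H] by auto

lemma H_finite: "finite H" "H \<noteq> {}"
  using fin subgroup.subset[OF H] subgroup.one_closed[OF H] by (auto dest: finite_subset)

lemma rep_H: "h \<in> H \<Longrightarrow> \<rho> h \<in> carrier_mat n n"
  using rep_carrier H_carrier by blast

lemma vs_carrier: "j < d \<Longrightarrow> vs ! j \<in> carrier_vec n"
  using basis unfolding is_basis_def invariants_def by (auto dest: nth_mem)

lemma index_V: "k < n \<Longrightarrow> j < d \<Longrightarrow> V $$ (k, j) = vs ! j $ k"
  unfolding V_def by (simp add: mat_of_cols_index)

lemma col_V: "j < d \<Longrightarrow> col V j = vs ! j"
  using vs_carrier unfolding V_def by simp

lemma lincomb_eq: "lincomb n cs vs = V *\<^sub>v vec d (\<lambda>j. cs ! j)"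
  unfolding lincomb_def using V_carrier
  by (intro eq_vecI) (auto simp: scalar_prod_def index_V atLeast0LessThan mult.commute intro!: sum.cong)

lemma rep_mult_V: "h \<in> H \<Longrightarrow> \<rho> h * V = V"
proof (rule eq_matI)
  fix i j assume h: "h \<in> H" and "i < dim_row V" "j < dim_col V"
  then have ij: "i < n" "j < d" using V_carrier by auto
  have "\<rho> h *\<^sub>v (vs ! j) = vs ! j"
    using basis ij h unfolding is_basis_def invariants_def by (auto dest: nth_mem)
  then have "(\<rho> h *\<^sub>v (vs ! j)) $ i = vs ! j $ i" by simp
  then show "(\<rho> h * V) $$ (i, j) = V $$ (i, j)"
    using ij rep_H[OF h] V_carrier by (simp add: col_V index_V)
qed (use rep_H V_carrier in auto)

lemma proj_mult_V: "proj * V = V"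
proof -
  have "proj * V = mat_avg n d H (\<lambda>h. \<rho> h * V)"
    unfolding proj_def by (rule mat_avg_mult[OF V_carrier rep_H])
  also have "\<dots> = mat_avg n d H (\<lambda>_. V)" by (rule mat_avg_cong) (rule rep_mult_V)
  also have "\<dots> = V" using H_finite V_carrier by (intro mat_avg_const)
  finally show ?thesis .
qed

lemma rep_mult_proj: "g \<in> H \<Longrightarrow> \<rho> g * proj = proj"
proof -
  assume g: "g \<in> H"
  have "\<rho> g * proj = mat_avg n n H (\<lambda>h. \<rho> g * \<rho> h)"
    unfolding proj_def by (rule mult_mat_avg[OF rep_H[OF g] rep_H])
  also have "\<dots> = mat_avg n n H (\<lambda>h. \<rho> (g \<otimes> h))"
    using g by (intro mat_avg_cong) (simp add: rep_mult H_carrier)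
  also have "\<dots> = proj"
    unfolding proj_def by (rule mat_avg_reindex[OF bij_betw_subgroup_mult[OF H g]])
  finally show ?thesis .
qed

text \<open>The columns of \<open>proj\<close> are invariant, and \<open>W\<close> collects their
  coordinates in the basis. Since \<open>V * (W * V) = proj * V = V\<close>, uniqueness of
  coordinates gives \<open>W * V = 1\<^sub>m d\<close>.\<close>

lemma coordinates_exist:
  obtains W where "W \<in> carrier_mat d n" "V * W = proj" "W * V = 1\<^sub>m d"
proof -
  have "col proj j \<in> invariants G n \<rho> H" if "j < n" for j
  proof -
    have "\<rho> h *\<^sub>v col proj j = col proj j" if h: "h \<in> H" for h
      using col_mult2[OF rep_H[OF h] proj_carrier \<open>j < n\<close>] rep_mult_proj[OF h] by simp
    then show ?thesis unfolding invariants_def using proj_carrier that by auto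
  qed
  then have "\<forall>j<n. \<exists>cs. lincomb n cs vs = col proj j"
    using basis unfolding is_basis_def by blast
  then obtain cs where cs: "\<And>j. j < n \<Longrightarrow> lincomb n (cs j) vs = col proj j" by metis
  define W where "W = mat d n (\<lambda>(i, j). cs j ! i)"
  have W: "W \<in> carrier_mat d n" unfolding W_def by simp
  have VW: "V * W = proj"
  proof (rule eq_matI)
    fix i j assume "i < dim_row proj" "j < dim_col proj"
    then have ij: "i < n" "j < n" using proj_carrier by auto
    have "col W j = vec d (\<lambda>i. cs j ! i)" unfolding W_def using ij by auto
    then have "V *\<^sub>v col W j = col proj j" using cs[OF ij(2)] unfolding lincomb_eq by simp
    then have "col (V * W) j = col proj j" using col_mult2[OF V_carrier W ij(2)] by simp
    moreover have "(V * W) $$ (i, j) = col (V * W) j $ i"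
      using ij V_carrier W by (intro index_col[symmetric]) auto
    ultimately show "(V * W) $$ (i, j) = proj $$ (i, j)" using ij proj_carrier by simp
  qed (use V_carrier W proj_carrier in auto)
  \<comment> \<open>Injectivity of \<open>V\<close> is needed only over basis vectors. The basis
    property speaks of coefficient lists, hence the passage through
    \<open>list_of_vec\<close>.\<close>
  have unique: "x = y" if "x \<in> carrier_vec d" "y \<in> carrier_vec d" "V *\<^sub>v x = V *\<^sub>v y" "V *\<^sub>v y \<in> set vs" for x y
  proof -
    have list: "lincomb n (list_of_vec z) vs = V *\<^sub>v z" "length (list_of_vec z) = d" if "z \<in> carrier_vec d" for z
    proof -
      have "vec d (\<lambda>j. list_of_vec z ! j) = z"
        using that by (intro eq_vecI) (auto simp: list_of_vec_index)
      then show "lincomb n (list_of_vec z) vs = V *\<^sub>v z" "length (list_of_vec z) = d"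
        using that unfolding lincomb_eq by auto
    qed
    have "V *\<^sub>v y \<in> invariants G n \<rho> H" using that(4) basis unfolding is_basis_def by auto
    then have "\<exists>!cs. length cs = d \<and> lincomb n cs vs = V *\<^sub>v y"
      using basis unfolding is_basis_def by blast
    then have "list_of_vec x = list_of_vec y" using list that(1,2,3) by metis
    then show ?thesis by (metis vec_list)
  qed
  have "W * V = 1\<^sub>m d"
  proof (rule mat_col_eqI)
    fix j assume "j < dim_col (1\<^sub>m d :: 'c mat)"
    then have j: "j < d" by simp
    have unit: "V *\<^sub>v unit_vec d j = vs ! j"
      using j V_carrier vs_carrier[OF j] by (intro eq_vecI) (auto simp: index_V)
    have "V *\<^sub>v col (W * V) j = V *\<^sub>v (W *\<^sub>v vs ! j)"
      using col_mult2[OF W V_carrier j] col_V[OF j] by simp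
    also have "\<dots> = proj *\<^sub>v vs ! j"
      using assoc_mult_mat_vec[OF V_carrier W vs_carrier[OF j]] VW by simp
    also have "\<dots> = vs ! j"
      using col_mult2[OF proj_carrier V_carrier j] proj_mult_V col_V[OF j] by simp
    finally have "V *\<^sub>v col (W * V) j = vs ! j" .
    then have "col (W * V) j = unit_vec d j"
      using j unit W V_carrier by - (rule unique, auto simp del: col_mult2)
    then show "col (W * V) j = col (1\<^sub>m d) j" using j by simp
  qed (use W V_carrier in auto)
  with W VW show ?thesis using that by blast
qed

lemma gram_mat_eq:
  assumes B: "B \<in> carrier_mat n n"
  shows "gram_mat B vs = transpose_mat V * B * V"
proof (rule eq_matI)
  fix i j assume "i < dim_row (transpose_mat V * B * V)" "j < dim_col (transpose_mat V * B * V)"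
  then have ij: "i < d" "j < d" using V_carrier by auto
  have "(transpose_mat V * B * V) $$ (i, j) = (transpose_mat V * (B * V)) $$ (i, j)"
    using V_carrier B by (simp add: assoc_mult_mat[of _ d n _ n _ d])
  also have "\<dots> = col V i \<bullet> col (B * V) j" using ij V_carrier B by simp
  also have "\<dots> = vs ! i \<bullet> (B *\<^sub>v vs ! j)"
    using ij V_carrier B by (simp only: col_V col_mult2[OF B V_carrier ij(2)])
  finally show "gram_mat B vs $$ (i, j) = (transpose_mat V * B * V) $$ (i, j)"
    using ij unfolding gram_mat_def by simp
qed (use V_carrier in \<open>auto simp: gram_mat_def\<close>)

text \<open>The Gram matrix is congruent to \<open>A\<close> through \<open>V\<close>, and taking
  transposes commutes with this.\<close>

lemma gram_mat_skew:
  assumes A: "A \<in> carrier_mat n n" and skew: "\<forall>i<n. \<forall>j<n. A $$ (j, i) = - A $$ (i, j)"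
    and ij: "i < d" "j < d"
  shows "gram_mat A vs $$ (j, i) = - gram_mat A vs $$ (i, j)"
proof -
  have At: "transpose_mat A = - A"
  proof (rule eq_matI)
    fix i j assume "i < dim_row (- A)" "j < dim_col (- A)"
    then have ij: "i < n" "j < n" using A by auto
    have "A $$ (j, i) = - A $$ (i, j)" using skew ij by blast
    then show "transpose_mat A $$ (i, j) = (- A) $$ (i, j)" using A ij by simp
  qed (use A in auto)
  have Vt: "transpose_mat V \<in> carrier_mat d n" using V_carrier by simp
  have "transpose_mat (gram_mat A vs) = transpose_mat V * (transpose_mat A * V)"
    unfolding gram_mat_eq[OF A] transpose_mult[OF mult_carrier_mat[OF Vt A] V_carrier]
      transpose_mult[OF Vt A] transpose_transpose by (rule refl)
  also have "\<dots> = - gram_mat A vs"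
    unfolding At gram_mat_eq[OF A] using A V_carrier Vt
    by (simp add: assoc_mult_mat[of _ d n _ n _ d])
  finally have "transpose_mat (gram_mat A vs) $$ (i, j) = (- gram_mat A vs) $$ (i, j)" by simp
  then show ?thesis using ij by (simp add: gram_mat_def)
qed

lemma commute_proj:
  assumes T: "T \<in> carrier_mat n n" and comm: "\<And>g. g \<in> carrier G \<Longrightarrow> T * \<rho> g = \<rho> g * T"
  shows "T * proj = proj * T"
proof -
  have "T * proj = mat_avg n n H (\<lambda>h. T * \<rho> h)"
    unfolding proj_def by (rule mult_mat_avg[OF T rep_H])
  also have "\<dots> = mat_avg n n H (\<lambda>h. \<rho> h * T)"
    by (rule mat_avg_cong) (simp add: comm H_carrier)
  also have "\<dots> = proj * T"
    unfolding proj_def by (rule mat_avg_mult[OF T rep_H, symmetric])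
  finally show ?thesis .
qed

text \<open>An invariant pairing makes \<open>proj\<close> self-adjoint, so the invariants pair
  nondegenerately with themselves.\<close>

lemma det_gram_mat_nonzero:
  assumes B: "invariant_pairing G n \<rho> B"
  shows "det (gram_mat B vs) \<noteq> 0"
proof -
  have Bc: "B \<in> carrier_mat n n" and "det B \<noteq> 0"
    and inv: "\<And>g. g \<in> carrier G \<Longrightarrow> transpose_mat (\<rho> g) * B * \<rho> g = B"
    using B unfolding invariant_pairing_def by auto
  then obtain B' where B': "B' \<in> carrier_mat n n" "B * B' = 1\<^sub>m n" "B' * B = 1\<^sub>m n"
    using inverse_mat_exists by metis
  obtain W where W: "W \<in> carrier_mat d n" "V * W = proj" "W * V = 1\<^sub>m d"
    by (rule coordinates_exist)
  \<comment> \<open>Invariance in adjoint form: the adjoint of \<open>\<rho> g\<close> is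
    \<open>\<rho> (inv g)\<close>. Averaging over \<open>H\<close>, which is closed under inverses,
    then makes \<open>proj\<close> its own adjoint.\<close>
  have shift: "transpose_mat (\<rho> g) * B = B * \<rho> (inv g)" if g: "g \<in> carrier G" for g
  proof -
    have "transpose_mat (\<rho> g) * B = transpose_mat (\<rho> g) * B * (\<rho> g * \<rho> (inv g))"
      using g Bc rep_carrier[OF g] by (simp flip: rep_mult add: rep_one)
    also have "\<dots> = transpose_mat (\<rho> g) * B * \<rho> g * \<rho> (inv g)"
      using g Bc rep_carrier[OF g] rep_carrier[of "inv g"] by (simp add: assoc_mult_mat[of _ n n _ n _ n])
    finally show ?thesis using inv[OF g] by simp
  qed
  have "transpose_mat proj * B = mat_avg n n H (\<lambda>h. transpose_mat (\<rho> h) * B)"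
  proof -
    have "transpose_mat proj = mat_avg n n H (\<lambda>h. transpose_mat (\<rho> h))"
      unfolding proj_def by (rule transpose_mat_avg[OF rep_H])
    then show ?thesis
      by (simp only:) (rule mat_avg_mult[OF Bc], use rep_H in auto)
  qed
  also have "\<dots> = mat_avg n n H (\<lambda>h. B * \<rho> (inv h))"
    by (rule mat_avg_cong) (simp add: shift H_carrier)
  also have "\<dots> = mat_avg n n H (\<lambda>h. B * \<rho> h)"
    by (rule mat_avg_reindex[OF bij_betw_subgroup_inv[OF H]])
  also have "\<dots> = B * proj" unfolding proj_def by (rule mult_mat_avg[OF Bc rep_H, symmetric])
  finally have adj: "transpose_mat proj * B = B * proj" .
  \<comment> \<open>The inverse of the Gram matrix.\<close>
  let ?Y = "W * B' * transpose_mat W"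
  have Vt: "transpose_mat V \<in> carrier_mat d n" and Wt: "transpose_mat W \<in> carrier_mat n d"
    and pt: "transpose_mat proj \<in> carrier_mat n n"
    using V_carrier W proj_carrier by auto
  \<comment> \<open>In the middle \<open>V * W\<close> becomes \<open>proj\<close>; self-adjointness
    moves it to the left of \<open>B\<close>, where \<open>B\<close> cancels against
    \<open>B'\<close>. What remains is the transpose of \<open>W * proj * V\<close>, the
    identity.\<close>
  have "(transpose_mat V * B * V) * ?Y = transpose_mat V * (B * (V * W)) * B' * transpose_mat W"
    using V_carrier W(1) Bc B'(1) Vt Wt
    by (simp add: assoc_mult_mat[of _ d n _ n _ d] assoc_mult_mat[of _ d n _ n _ n]
        assoc_mult_mat[of _ d n _ d _ n] assoc_mult_mat[of _ d n _ d _ d]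
        assoc_mult_mat[of _ n n _ d _ n] assoc_mult_mat[of _ n d _ n _ n] assoc_mult_mat[of _ n d _ n _ d]
        assoc_mult_mat[of _ n n _ n _ n] assoc_mult_mat[of _ n n _ n _ d] assoc_mult_mat[of _ n n _ d _ d])
  also have "\<dots> = transpose_mat V * transpose_mat proj * (B * B') * transpose_mat W"
    unfolding W(2) adj[symmetric] using Bc B'(1) Vt Wt pt
    by (simp add: assoc_mult_mat[of _ d n _ n _ d] assoc_mult_mat[of _ d n _ n _ n]
        assoc_mult_mat[of _ n n _ n _ n] assoc_mult_mat[of _ n n _ n _ d])
  also have "\<dots> = transpose_mat V * transpose_mat proj * transpose_mat W"
    unfolding B'(2) using Vt pt by simp
  also have "\<dots> = transpose_mat (W * (proj * V))"
    using V_carrier W(1) proj_carrier by (simp add: transpose_mult[of _ d n _ d] transpose_mult[of _ n n _ d])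
  also have "\<dots> = 1\<^sub>m d" unfolding proj_mult_V W(3) by simp
  finally have "det (transpose_mat V * B * V) * det ?Y = 1"
    using det_mult[of "transpose_mat V * B * V" d ?Y] V_carrier W(1) Bc B'(1) by auto
  then show ?thesis unfolding gram_mat_eq[OF Bc] by auto
qed

text \<open>\<open>S\<close> is the matrix of \<open>T\<close> on the invariants, which
  \<open>T\<close> preserves because it commutes with \<open>proj\<close>. Cyclicity of the trace
  turns the trace of \<open>S ^\<^sub>m k = W * (T ^\<^sub>m k * V)\<close> into that of
  \<open>T ^\<^sub>m k * proj\<close>, and \<open>proj\<close> is a mean over
  \<open>H\<close>.\<close>

lemma endomorphism_restriction:
  assumes T: "T \<in> carrier_mat n n" and comm: "\<And>g. g \<in> carrier G \<Longrightarrow> T * \<rho> g = \<rho> g * T"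
  obtains S where "S \<in> carrier_mat d d" "T * V = V * S"
    "\<And>k. mat_trace (S ^\<^sub>m k) = (\<Sum>h\<in>H. mat_trace (T ^\<^sub>m k * \<rho> h)) / of_nat (card H)"
proof -
  obtain W where W: "W \<in> carrier_mat d n" "V * W = proj" "W * V = 1\<^sub>m d"
    by (rule coordinates_exist)
  define S where "S = W * (T * V)"
  have TV: "T * V \<in> carrier_mat n d" using T V_carrier by auto
  have S: "S \<in> carrier_mat d d" unfolding S_def using W TV by auto
  have "T * V = T * proj * V"
    using assoc_mult_mat[OF T proj_carrier V_carrier] proj_mult_V by simp
  also have "T * proj = proj * T" by (rule commute_proj[OF assms])
  also have "proj * T * V = proj * (T * V)" by (rule assoc_mult_mat[OF proj_carrier T V_carrier])
  also have "\<dots> = V * S"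
    unfolding S_def W(2)[symmetric] by (rule assoc_mult_mat[OF V_carrier W(1) TV])
  finally have TVS: "T * V = V * S" .
  have pow: "T ^\<^sub>m k * V = V * S ^\<^sub>m k" for k
  proof (induction k)
    case 0
    then show ?case using T V_carrier S by simp
  next
    case (Suc k)
    note Tk = pow_carrier_mat[OF T, of k] and Sk = pow_carrier_mat[OF S, of k]
    have "T ^\<^sub>m Suc k * V = T ^\<^sub>m k * (V * S)"
      using assoc_mult_mat[OF Tk T V_carrier] TVS by simp
    also have "\<dots> = V * S ^\<^sub>m k * S"
      using assoc_mult_mat[OF Tk V_carrier S] Suc by simp
    also have "\<dots> = V * S ^\<^sub>m Suc k"
      using assoc_mult_mat[OF V_carrier Sk S] by simp
    finally show ?case .
  qed
  have "mat_trace (S ^\<^sub>m k) = (\<Sum>h\<in>H. mat_trace (T ^\<^sub>m k * \<rho> h)) / of_nat (card H)" for k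
  proof -
    note Tk = pow_carrier_mat[OF T, of k] and Sk = pow_carrier_mat[OF S, of k]
    have TkV: "T ^\<^sub>m k * V \<in> carrier_mat n d" using Tk V_carrier by auto
    have "S ^\<^sub>m k = W * V * S ^\<^sub>m k"
      unfolding W(3) by (rule left_mult_one_mat[OF Sk, symmetric])
    also have "\<dots> = W * (T ^\<^sub>m k * V)"
      unfolding pow by (rule assoc_mult_mat[OF W(1) V_carrier Sk])
    finally have "mat_trace (S ^\<^sub>m k) = mat_trace (T ^\<^sub>m k * V * W)"
      using mat_trace_mult_commute[OF W(1) TkV] by simp
    also have "T ^\<^sub>m k * V * W = T ^\<^sub>m k * proj"
      using assoc_mult_mat[OF Tk V_carrier W(1)] W(2) by simp
    also have "\<dots> = mat_avg n n H (\<lambda>h. T ^\<^sub>m k * \<rho> h)"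
      unfolding proj_def by (rule mult_mat_avg[OF Tk rep_H])
    also have "mat_trace \<dots> = (\<Sum>h\<in>H. mat_trace (T ^\<^sub>m k * \<rho> h)) / of_nat (card H)"
      by (rule mat_trace_avg) (use rep_H Tk in auto)
    finally show ?thesis .
  qed
  with S TVS show ?thesis using that by blast
qed

end


section \<open>Comparison of pairings\<close>

text \<open>The eigenvalue argument takes place in the algebraically closed field; injectivity of
  \<open>e\<close> brings the identity back and supplies characteristic zero.\<close>

lemma prod_det_eq_1_if_trace_powers_embedded:
  fixes T :: "nat \<Rightarrow> 'k::field_char_0 mat" and n :: "nat \<Rightarrow> int" and e :: "'k \<Rightarrow> 'l::alg_closed_field"
  assumes e: "field_embedding e"
    and T: "\<And>i. i < N \<Longrightarrow> T i \<in> carrier_mat (d i) (d i)"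
    and det: "\<And>i. i < N \<Longrightarrow> det (T i) \<noteq> 0"
    and traces: "\<And>k. (\<Sum>i<N. of_int (n i) * mat_trace (T i ^\<^sub>m k)) = 0"
  shows "(\<Prod>i<N. det (T i) powi n i) = 1"
proof -
  interpret e: comm_ring_hom e using e by (rule comm_ring_hom_field_embedding)
  have e_eq_iff: "e x = e y \<longleftrightarrow> x = y" for x y
    using e unfolding field_embedding_def by (auto dest: injD)
  have e_inverse: "e (inverse x) = inverse (e x)" if "x \<noteq> 0" for x
    using that by (intro inverse_unique[symmetric]) (simp flip: e.hom_mult)
  have e_powi: "e (x powi k) = e x powi k" if "x \<noteq> 0" for x k
    using that by (simp add: power_int_def e.hom_power e_inverse)
  have e_trace: "mat_trace (map_mat e (T i) ^\<^sub>m k) = e (mat_trace (T i ^\<^sub>m k))" if "i < N" for i k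
    using T[OF that] pow_carrier_mat[OF T[OF that], of k]
    by (auto simp flip: e.mat_hom_pow[OF T[OF that]] simp: mat_trace_def e.hom_sum intro!: sum.cong)
  have "(\<Prod>i<N. det (map_mat e (T i)) powi n i) = 1"
  proof (rule prod_det_eq_1_if_trace_powers)
    show "z = 0" if "of_int z = (0::'l)" for z
    proof -
      have "e (of_int z) = e 0" using that by (simp add: e.hom_of_int)
      then show ?thesis unfolding e_eq_iff by simp
    qed
    show "map_mat e (T i) \<in> carrier_mat (d i) (d i)" if "i < N" for i using T[OF that] by simp
    show "det (map_mat e (T i)) \<noteq> 0" if "i < N" for i
      using det[OF that] e_eq_iff[of "det (T i)" 0] by simp
    show "(\<Sum>i<N. of_int (n i) * mat_trace (map_mat e (T i) ^\<^sub>m k)) = 0" for k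
    proof -
      have "(\<Sum>i<N. of_int (n i) * mat_trace (map_mat e (T i) ^\<^sub>m k))
          = e (\<Sum>i<N. of_int (n i) * mat_trace (T i ^\<^sub>m k))"
        unfolding e.hom_sum by (intro sum.cong[OF refl]) (simp add: e_trace e.hom_mult e.hom_of_int)
      then show ?thesis using traces by simp
    qed
  qed
  moreover have "e (\<Prod>i<N. det (T i) powi n i) = (\<Prod>i<N. det (map_mat e (T i)) powi n i)"
    unfolding e.hom_prod by (intro prod.cong[OF refl]) (simp add: e_powi det)
  ultimately show ?thesis using e_eq_iff[of _ 1] by simp
qed

context finite_group_rep
begin

text \<open>\<open>T\<close> is the inverse of \<open>A\<close> times \<open>B\<close>. Invariance
  of both pairings shows that \<open>T * \<rho> g\<close> and \<open>\<rho> g * T\<close> agree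
  after multiplication by \<open>transpose_mat (\<rho> g) * A\<close>.\<close>

lemma pairing_quotient:
  assumes A: "invariant_pairing G n \<rho> A" and B: "invariant_pairing G n \<rho> B"
  obtains T where "T \<in> carrier_mat n n" "A * T = B" "\<And>g. g \<in> carrier G \<Longrightarrow> T * \<rho> g = \<rho> g * T"
proof -
  have Ac: "A \<in> carrier_mat n n" "det A \<noteq> 0"
    and Ainv: "\<And>g. g \<in> carrier G \<Longrightarrow> transpose_mat (\<rho> g) * A * \<rho> g = A"
    using A unfolding invariant_pairing_def by auto
  have Bc: "B \<in> carrier_mat n n"
    and Binv: "\<And>g. g \<in> carrier G \<Longrightarrow> transpose_mat (\<rho> g) * B * \<rho> g = B"
    using B unfolding invariant_pairing_def by auto
  obtain A' where A': "A' \<in> carrier_mat n n" "A * A' = 1\<^sub>m n" "A' * A = 1\<^sub>m n"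
    using inverse_mat_exists[OF Ac] by metis
  define T where "T = A' * B"
  have T: "T \<in> carrier_mat n n" unfolding T_def using A' Bc by auto
  have AT: "A * T = B"
    unfolding T_def assoc_mult_mat[OF Ac(1) A'(1) Bc, symmetric] A'(2) by (rule left_mult_one_mat[OF Bc])
  have "T * \<rho> g = \<rho> g * T" if g: "g \<in> carrier G" for g
  proof -
    note \<rho>g = rep_carrier[OF g]
    \<comment> \<open>\<open>L\<close> can be cancelled because \<open>L * \<rho> g = A\<close> has
      nonzero determinant.\<close>
    define L where "L = transpose_mat (\<rho> g) * A"
    have L: "L \<in> carrier_mat n n" unfolding L_def using \<rho>g Ac by auto
    have LA: "L * \<rho> g = A" unfolding L_def by (rule Ainv[OF g])
    have "det L \<noteq> 0" using det_mult[OF L \<rho>g] Ac(2) unfolding LA by auto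
    then obtain L' where L': "L' \<in> carrier_mat n n" "L' * L = 1\<^sub>m n"
      using inverse_mat_exists[OF L] by metis
    have cancel: "X = L' * (L * X)" if "X \<in> carrier_mat n n" for X
      using assoc_mult_mat[OF L'(1) L that] left_mult_one_mat[OF that] L'(2) by simp
    have "L * (T * \<rho> g) = transpose_mat (\<rho> g) * (A * T) * \<rho> g"
      unfolding L_def using \<rho>g Ac T by (simp add: assoc_mult_mat[of _ n n _ n _ n])
    also have "\<dots> = L * \<rho> g * T" unfolding LA AT by (rule Binv[OF g])
    also have "\<dots> = L * (\<rho> g * T)" by (rule assoc_mult_mat[OF L \<rho>g T])
    finally show ?thesis
      using cancel[OF mult_carrier_mat[OF T \<rho>g]] cancel[OF mult_carrier_mat[OF \<rho>g T]] by simp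
  qed
  with T AT show ?thesis using that by blast
qed

lemma commute_pow:
  assumes T: "T \<in> carrier_mat n n" and comm: "\<And>g. g \<in> carrier G \<Longrightarrow> T * \<rho> g = \<rho> g * T"
    and g: "g \<in> carrier G"
  shows "T ^\<^sub>m k * \<rho> g = \<rho> g * T ^\<^sub>m k"
proof (induction k)
  case 0
  show ?case using T rep_carrier[OF g] by simp
next
  case (Suc k)
  note Tk = pow_carrier_mat[OF T, of k] and \<rho>g = rep_carrier[OF g]
  have "T ^\<^sub>m Suc k * \<rho> g = T ^\<^sub>m k * \<rho> g * T"
    using assoc_mult_mat[OF Tk T \<rho>g] comm[OF g] assoc_mult_mat[OF Tk \<rho>g T] by simp
  also have "\<dots> = \<rho> g * T ^\<^sub>m Suc k"
    unfolding Suc using assoc_mult_mat[OF \<rho>g Tk T] by simp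
  finally show ?case .
qed

text \<open>Makes the trace of \<open>T * \<rho> g\<close> a class function of g:
  \<open>\<rho> x\<close> moves around the trace and past \<open>T\<close>.\<close>

lemma trace_conjugation_invariant:
  assumes T: "T \<in> carrier_mat n n" and comm: "\<And>g. g \<in> carrier G \<Longrightarrow> T * \<rho> g = \<rho> g * T"
    and x: "x \<in> carrier G" and g: "g \<in> carrier G"
  shows "mat_trace (T * \<rho> (inv x \<otimes> g \<otimes> x)) = mat_trace (T * \<rho> g)"
proof -
  note \<rho>x = rep_carrier[OF x] and \<rho>y = rep_carrier[OF m_closed[OF inv_closed[OF x] g]]
  have "mat_trace (T * \<rho> (inv x \<otimes> g \<otimes> x)) = mat_trace (T * \<rho> (inv x \<otimes> g) * \<rho> x)"
    using x g assoc_mult_mat[OF T \<rho>y \<rho>x] by (simp add: rep_mult)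
  also have "\<dots> = mat_trace (\<rho> x * (T * \<rho> (inv x \<otimes> g)))"
    by (rule mat_trace_mult_commute[OF mult_carrier_mat[OF T \<rho>y] \<rho>x])
  also have "\<rho> x * (T * \<rho> (inv x \<otimes> g)) = T * (\<rho> x * \<rho> (inv x \<otimes> g))"
    using assoc_mult_mat[OF \<rho>x T \<rho>y] comm[OF x] assoc_mult_mat[OF T \<rho>x \<rho>y] by simp
  also have "\<rho> x * \<rho> (inv x \<otimes> g) = \<rho> g"
    using x g by (simp flip: rep_mult m_assoc)
  finally show ?thesis .
qed

text \<open>On each space of invariants the scaled Gram determinant of \<open>B\<close> is that of
  \<open>A\<close>, a square by skewness, times the determinant of \<open>T\<close> restricted
  there. The weighted product of the latter determinants is 1.\<close>

lemma reg_const_trivial_if_skew_pairing: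
  fixes e :: "'k \<Rightarrow> 'l::alg_closed_field"
  assumes e: "field_embedding e" and rel: "G_relation G \<Theta>"
    and A: "invariant_pairing G n \<rho> A" and skew: "\<forall>i<n. \<forall>j<n. A $$ (j, i) = - A $$ (i, j)"
  shows "reg_const_trivial G n \<rho> \<Theta>"
  unfolding reg_const_trivial_def
proof (intro allI impI, elim conjE)
  fix B bs
  assume B: "invariant_pairing G n \<rho> B"
    and bs: "\<forall>i<length \<Theta>. is_basis n (invariants G n \<rho> (fst (\<Theta> ! i))) (bs i)"
  let ?N = "length \<Theta>" and ?H = "\<lambda>i. fst (\<Theta> ! i)" and ?m = "\<lambda>i. snd (\<Theta> ! i)"
  have sub: "subgroup (?H i) G" if "i < ?N" for i
    using rel that unfolding G_relation_def by blast
  have Ac: "A \<in> carrier_mat n n" and Bc: "B \<in> carrier_mat n n"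
    using A B unfolding invariant_pairing_def by auto
  obtain T where T: "T \<in> carrier_mat n n" "A * T = B"
    and comm: "\<And>g. g \<in> carrier G \<Longrightarrow> T * \<rho> g = \<rho> g * T"
    using pairing_quotient[OF A B] by metis
  define s where "s i = (1 / of_nat (card (?H i)) :: 'k)" for i
  \<comment> \<open>Here \<open>S\<close> is the matrix of \<open>T\<close> on the invariants in the
    basis \<open>bs i\<close>, and \<open>c ^ 2\<close> is the scaled Gram determinant of
    \<open>A\<close>.\<close>
  have "\<exists>S c. S \<in> carrier_mat (length (bs i)) (length (bs i)) \<and> det S \<noteq> 0 \<and> c \<noteq> 0
      \<and> det (s i \<cdot>\<^sub>m gram_mat B (bs i)) = c ^ 2 * det S
      \<and> (\<forall>k. mat_trace (S ^\<^sub>m k) = (\<Sum>h\<in>?H i. mat_trace (T ^\<^sub>m k * \<rho> h)) / of_nat (card (?H i)))"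
    if i: "i < ?N" for i
  proof -
    interpret subgroup_invariants G n \<rho> "?H i" "bs i"
      by (intro subgroup_invariants.intro subgroup_invariants_axioms.intro finite_group_rep_axioms)
        (use sub bs i in auto)
    obtain S where S: "S \<in> carrier_mat d d" "T * V = V * S"
      "\<And>k. mat_trace (S ^\<^sub>m k) = (\<Sum>h\<in>?H i. mat_trace (T ^\<^sub>m k * \<rho> h)) / of_nat (card (?H i))"
      using endomorphism_restriction[OF T(1) comm] by metis
    have gramA: "gram_mat A (bs i) \<in> carrier_mat d d" and gramB: "gram_mat B (bs i) \<in> carrier_mat d d"
      unfolding gram_mat_def by simp_all
    have VtA: "transpose_mat V * A \<in> carrier_mat d n" using V_carrier Ac by auto
    have "gram_mat B (bs i) = transpose_mat V * (A * T) * V"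
      using gram_mat_eq[OF Bc] T(2) by simp
    also have "transpose_mat V * (A * T) = transpose_mat V * A * T"
      using V_carrier by (intro assoc_mult_mat[OF _ Ac T(1), symmetric]) simp
    also have "transpose_mat V * A * T * V = transpose_mat V * A * (V * S)"
      unfolding S(2)[symmetric] by (rule assoc_mult_mat[OF VtA T(1) V_carrier])
    also have "\<dots> = gram_mat A (bs i) * S"
      unfolding gram_mat_eq[OF Ac] by (rule assoc_mult_mat[OF VtA V_carrier S(1), symmetric])
    finally have gram: "gram_mat B (bs i) = gram_mat A (bs i) * S" .
    have "s i \<noteq> 0" unfolding s_def using H_finite by simp
    have "s i \<cdot>\<^sub>m gram_mat B (bs i) = (s i \<cdot>\<^sub>m gram_mat A (bs i)) * S"
      unfolding gram by (rule mult_smult_assoc_mat[OF gramA S(1), symmetric])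
    then have det: "det (s i \<cdot>\<^sub>m gram_mat B (bs i)) = det (s i \<cdot>\<^sub>m gram_mat A (bs i)) * det S"
      using det_mult[OF smult_carrier_mat[OF gramA] S(1)] by simp
    \<comment> \<open>Nonvanishing of this product forces both \<open>c\<close> and
      \<open>det S\<close> to be nonzero.\<close>
    moreover have "det (s i \<cdot>\<^sub>m gram_mat B (bs i)) \<noteq> 0"
      using det_gram_mat_nonzero[OF B] \<open>s i \<noteq> 0\<close> by simp
    moreover obtain c where c: "det (s i \<cdot>\<^sub>m gram_mat A (bs i)) = c ^ 2"
    proof -
      have entry: "(s i \<cdot>\<^sub>m gram_mat A (bs i)) $$ (q, p) = - (s i \<cdot>\<^sub>m gram_mat A (bs i)) $$ (p, q)"
        if "p < d" "q < d" for p q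
        using gram_mat_skew[OF Ac skew that] gramA that by simp
      \<comment> \<open>Skewness makes twice the diagonal entry vanish, hence the entry itself in
        characteristic zero.\<close>
      have diag: "(s i \<cdot>\<^sub>m gram_mat A (bs i)) $$ (p, p) = 0" if "p < d" for p
        using entry[OF that that] by (simp only: eq_neg_iff_add_eq_0) (simp flip: mult_2)
      show ?thesis
        using det_skew_symmetric_square[OF smult_carrier_mat[OF gramA] entry diag] that by blast
    qed
    ultimately show ?thesis using S by (intro exI[of _ S] exI[of _ c]) auto
  qed
  then obtain S c where Sc: "\<And>i. i < ?N \<Longrightarrow> S i \<in> carrier_mat (length (bs i)) (length (bs i))"
    "\<And>i. i < ?N \<Longrightarrow> det (S i) \<noteq> 0" "\<And>i. i < ?N \<Longrightarrow> c i \<noteq> 0"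
    "\<And>i. i < ?N \<Longrightarrow> det (s i \<cdot>\<^sub>m gram_mat B (bs i)) = c i ^ 2 * det (S i)"
    and traces: "\<And>i k. i < ?N \<Longrightarrow>
      mat_trace (S i ^\<^sub>m k) = (\<Sum>h\<in>?H i. mat_trace (T ^\<^sub>m k * \<rho> h)) / of_nat (card (?H i))"
    by metis
  have "(\<Prod>i<?N. det (S i) powi ?m i) = 1"
  proof (rule prod_det_eq_1_if_trace_powers_embedded[OF e Sc(1,2)])
    fix k
    have "(\<Sum>i<?N. of_int (?m i) * mat_trace (S i ^\<^sub>m k))
        = (\<Sum>i<?N. of_int (?m i) * ((\<Sum>h\<in>?H i. mat_trace (T ^\<^sub>m k * \<rho> h)) / of_nat (card (?H i))))"
      by (intro sum.cong[OF refl]) (simp add: traces)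
    also have "\<dots> = 0"
    proof (rule G_relation_sum_class_function[OF _ fin rel])
      show "mat_trace (T ^\<^sub>m k * \<rho> (inv x \<otimes> g \<otimes> x)) = mat_trace (T ^\<^sub>m k * \<rho> g)"
        if "x \<in> carrier G" "g \<in> carrier G" for x g
        using pow_carrier_mat[OF T(1)] commute_pow[OF T(1) comm] that
        by (rule trace_conjugation_invariant)
    qed (rule sub)
    finally show "(\<Sum>i<?N. of_int (?m i) * mat_trace (S i ^\<^sub>m k)) = 0" .
  qed
  \<comment> \<open>The factors \<open>det (S i)\<close> multiply to 1, leaving only the
    squares.\<close>
  then have "reg_const_value \<Theta> B bs = (\<Prod>i<?N. (c i ^ 2) powi ?m i)"
    unfolding reg_const_value_def s_def[symmetric]
    by (simp add: Sc(4) power_int_mult_distrib prod.distrib del: det_smult)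
  also have "\<dots> = (\<Prod>i<?N. c i powi ?m i) ^ 2"
    by (simp add: prod.distrib power2_eq_square power_int_mult_distrib)
  finally show "\<exists>c. c \<noteq> 0 \<and> reg_const_value \<Theta> B bs = c ^ 2"
    using Sc(3) by (intro exI[of _ "\<Prod>i<?N. c i powi ?m i"]) auto
qed

end

theorem theorem2p16:
  fixes G :: "('a, 'b) monoid_scheme"
    and n :: nat
    and \<rho> :: "'a \<Rightarrow> 'k::field_char_0 mat"
    and e :: "'k \<Rightarrow> 'l::alg_closed_field"
  assumes "group G" and "finite (carrier G)"
    and "is_rep G n \<rho>"
    and "self_dual G n \<rho>"
    and "is_algebraic_closure e"
    and "\<exists>A \<in> carrier_mat n n. invariant_pairing G n (\<lambda>g. map_mat e (\<rho> g)) A \<and> alternating n A"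
  shows "\<forall>\<Theta>. G_relation G \<Theta> \<longrightarrow> reg_const_trivial G n \<rho> \<Theta>"
proof (intro allI impI)
  fix \<Theta> assume rel: "G_relation G \<Theta>"
  have e: "field_embedding e" using assms(5) unfolding is_algebraic_closure_def by blast
  interpret finite_group_rep G n \<rho>
    using assms(1-3) by (simp add: finite_group_rep_def finite_group_rep_axioms_def)
  obtain A where "invariant_pairing G n \<rho> A" "\<forall>i<n. \<forall>j<n. A $$ (j, i) = - A $$ (i, j)"
    using assms(6) skew_invariant_pairing_descent[OF assms(2,3) e] by blast
  then show "reg_const_trivial G n \<rho> \<Theta>"
    by (rule reg_const_trivial_if_skew_pairing[OF e rel])
qed

end
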